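(* Let $f,\mathcal X,\mathcal Y,\ell,D_{\mathcal Y}$ be as in the context and let $\{(x^t,y^t,z^t)\}_{t\ge0}$ be generated by Perturbed Smoothed GDA with parameters satisfying the step-size conditions for Perturbed Smoothed GDA listed in the context. Given any $\epsilon>0$: (i) (Game stationarity) If $r_y^t=r_y$ for all $t\ge0$ with $r_y=\Theta(\epsilon/D_{\mathcal Y})$, then there exists an index $t\le O\big(\ell^2D_{\mathcal Y}\Delta_{\Psi_2}/\epsilon^3\big)$ such that $(x^t,y^t)$ is an $\epsilon$-GS of $\min_{x\in\mathcal X}\max_{y\in\mathcal Y}f(x,y)$. (ii) (Optimization stationarity) If $r_y^t=r_y$ for all $t\ge0$ with $r_y=\Theta\big(\epsilon^2/(\ell D_{\mathcal Y}^2)\big)$, then there exists an index $t\le O\big(\ell^3D_{\mathcal Y}^2\Delta_{\Psi_2}/\epsilon^4\big)$ such that $x^t$ is an $\epsilon$-OS of $\min_{x\in\mathcal X}\max_{y\in\mathcal Y}f(x,y)$.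
   Context: Setting: $f:\mathbb R^n\times\mathbb R^d\to\mathbb R$; $\mathcal X\subseteq\mathbb R^n$ is nonempty, closed and convex; $\mathcal Y\subseteq\mathbb R^d$ is nonempty, compact and convex with $0\in\mathcal Y$ and diameter $D_{\mathcal Y}>0$. The function $f$ is continuously differentiable and $\ell$-smooth ($\ell>0$): for all $x,x'\in\mathcal X$, $y,y'\in\mathcal Y$, both $\|\nabla_xf(x,y)-\nabla_xf(x',y')\|$ and $\|\nabla_yf(x,y)-\nabla_yf(x',y')\|$ are at most $\ell(\|x-x'\|+\|y-y'\|)$. For each $x\in\mathcal X$, $f(x,\cdot)$ is concave. Stationarity: $\iota_S$ is the indicator function of a set $S$ ($0$ on $S$, $+\infty$ outside), and $\partial\iota_S$ its subdifferential. A pair $(x,y)\in\mathcal X\times\mathcal Y$ is an $\epsilon$-game-stationary point ($\epsilon$-GS) if $\mathrm{dist}(0,\nabla_xf(x,y)+\partial\iota_{\mathcal X}(x))\le\epsilon$ and $\mathrm{dist}(0,-\nabla_yf(x,y)+\partial\iota_{\mathcal Y}(y))\le\epsilon$. Let $\Phi(x)=\max_{y'\in\mathcal Y}f(x,y')+\iota_{\mathcal X}(x)$. A point $x\in\mathcal X$ is an $\epsilon$-optimization-stationary point ($\epsilon$-OS) if $\|\mathrm{prox}_{\frac{1}{2\ell}\Phi}(x)-x\|\le\frac{\epsilon}{2\ell}$, where $\mathrm{prox}_{\frac1{2\ell}\Phi}(x)=\arg\min_{w}\{\Phi(w)+\ell\|w-x\|^2\}$. Perturbed Smoothed GDA: let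 $F_t(x,y,z)=f(x,y)+\frac{r_x}{2}\|x-z\|^2-\frac{r_y^t}{2}\|y\|^2$. From $(x^0,y^0,z^0)$, iterate for $t=0,1,\dots$ $$x^{t+1}=\mathrm{proj}_{\mathcal X}(x^t-c^t\nabla_xF_t(x^t,y^t,z^t)),\quad y^{t+1}=\mathrm{proj}_{\mathcal Y}(y^t+\alpha^t\nabla_yF_t(x^{t+1},y^t,z^t)),\quad z^{t+1}=z^t+\beta^t(x^{t+1}-z^t).$$ Step-size conditions for Perturbed Smoothed GDA: $r_x=\Theta(\ell)$ with $r_x>3\ell$, $r_y^t>0$, and for all $t\ge0$: $\alpha^t=\Theta(1/\ell)$ and $0<\alpha^t\le\min\Big\{\frac{1}{11(\ell+r_y^t)},\frac{(c^t)^2(r_x-\ell-r_y^t)^2}{4(\ell+r_y^t)(1+c^t(r_x-\ell-r_y^t))^2}\Big\}$; $c^t=\Theta(1/\ell)$ and $0<c^t<\frac{1}{r_x+\ell+r_y^t}$; $0<\beta^t\le\min\Big\{\frac1{36},\frac{(r_x-\ell-r_y^t)^2}{384r_x(r_x+\ell+r_y^t)^2}\Big\}$; $\beta^t=\Theta(r_y^t/\ell)$ and $0<\beta^t\le\frac{1}{384r_x\alpha^t(\omega^t)^2}$, where $\omega^t=\frac{1}{\sqrt{r_y^t}}\cdot\frac{(r_x-\ell-r_y^t)+\alpha^t(\ell+r_y^t)(3r_x-2\ell-2r_y^t)}{\alpha^t(r_x-\ell-r_y^t)^{3/2}}$. Initial gap: with $f_0(x,y)=f(x,y)-\frac{r_y^0}{2}\|y\|^2$,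 $\Delta_{\Psi_2}=\Psi_2^0(x^0,y^0,z^0)-\min_{x\in\mathcal X}\max_{y\in\mathcal Y}f_0(x,y)$, where $\Psi_2^0(x,y,z)=F_0(x,y,z)-2\min_{x'\in\mathcal X}F_0(x',y,z)+2\min_{x'\in\mathcal X}\max_{y'\in\mathcal Y}F_0(x',y',z)$; it is understood to be a finite number. Conventions: $\epsilon\in(0,1)$ is a sufficiently small positive number. $O$ and $\Theta$ hide positive constants not depending on $\epsilon$, $\ell$, $D_{\mathcal Y}$, $\Delta_{\Psi_2}$ or the iteration index.
   Formalization: The hidden upper constant in r_y=Θ(·) must be below an absolute constant (the claim fails for large constants); "ε sufficiently small" may depend on the Θ constants, ℓ, D and a positive lower bound on the gap (a zero gap is also allowed); the start satisfies x^0∈X, y^0∈Y. *)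

theory Defs
  imports "HOL-Analysis.Analysis"
begin

definition grad :: "('a::real_inner \<Rightarrow> real) \<Rightarrow> 'a \<Rightarrow> 'a" where
  "grad g u = (THE D. GDERIV g u :> D)"

definition grad_x :: "('a::real_inner \<times> 'b \<Rightarrow> real) \<Rightarrow> 'a \<Rightarrow> 'b \<Rightarrow> 'a" where
  "grad_x f x y = grad (\<lambda>x'. f (x', y)) x"

definition grad_y :: "('a \<times> 'b::real_inner \<Rightarrow> real) \<Rightarrow> 'a \<Rightarrow> 'b \<Rightarrow> 'b" where
  "grad_y f x y = grad (\<lambda>y'. f (x, y')) y"

definition continuously_differentiable :: "('a::real_inner \<Rightarrow> real) \<Rightarrow> bool" where
  "continuously_differentiable g \<longleftrightarrow>
     (\<forall>u. g differentiable (at u)) \<and> continuous_on UNIV (grad g)"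

definition l_smooth_on ::
    "real \<Rightarrow> 'a::real_inner set \<Rightarrow> 'b::real_inner set \<Rightarrow> ('a \<times> 'b \<Rightarrow> real) \<Rightarrow> bool" where
  "l_smooth_on l X Y f \<longleftrightarrow>
     (\<forall>x\<in>X. \<forall>x'\<in>X. \<forall>y\<in>Y. \<forall>y'\<in>Y.
        norm (grad_x f x y - grad_x f x' y') \<le> l * (norm (x - x') + norm (y - y')) \<and>
        norm (grad_y f x y - grad_y f x' y') \<le> l * (norm (x - x') + norm (y - y')))"

definition minimax_problem ::
    "('a::euclidean_space \<times> 'b::euclidean_space \<Rightarrow> real) \<Rightarrow> 'a set \<Rightarrow> 'b set \<Rightarrow> real \<Rightarrow> bool" where
  "minimax_problem f X Y l \<longleftrightarrow>
     X \<noteq> {} \<and> closed X \<and> convex X \<and>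
     Y \<noteq> {} \<and> compact Y \<and> convex Y \<and> 0 \<in> Y \<and> diameter Y > 0 \<and>
     continuously_differentiable f \<and> l > 0 \<and> l_smooth_on l X Y f \<and>
     (\<forall>x\<in>X. concave_on Y (\<lambda>y. f (x, y)))"

definition convex_indicator :: "'a set \<Rightarrow> 'a \<Rightarrow> ereal" where
  "convex_indicator S x = (if x \<in> S then 0 else \<infinity>)"

definition subdifferential :: "('a::real_inner \<Rightarrow> ereal) \<Rightarrow> 'a \<Rightarrow> 'a set" where
  "subdifferential g x = {v. \<forall>w. g x + ereal (v \<bullet> (w - x)) \<le> g w}"

text \<open>\<open>infdist\<close> is \<open>0\<close> for an empty set, but here the sets are nonempty: the subdifferential
  of the indicator of \<open>S\<close> contains \<open>0\<close> at every point of \<open>S\<close>.\<close>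

definition game_stationary ::
    "('a::real_inner \<times> 'b::real_inner \<Rightarrow> real) \<Rightarrow> 'a set \<Rightarrow> 'b set \<Rightarrow> real \<Rightarrow> 'a \<Rightarrow> 'b \<Rightarrow> bool" where
  "game_stationary f X Y \<epsilon> x y \<longleftrightarrow>
     x \<in> X \<and> y \<in> Y \<and>
     infdist 0 ((\<lambda>v. grad_x f x y + v) ` subdifferential (convex_indicator X) x) \<le> \<epsilon> \<and>
     infdist 0 ((\<lambda>v. - grad_y f x y + v) ` subdifferential (convex_indicator Y) y) \<le> \<epsilon>"

definition prox :: "real \<Rightarrow> ('a::real_normed_vector \<Rightarrow> ereal) \<Rightarrow> 'a \<Rightarrow> 'a" where
  "prox \<mu> g x = arg_min (\<lambda>w. g w + ereal (1 / (2 * \<mu>) * (norm (w - x))\<^sup>2)) (\<lambda>_. True)"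

definition Phi :: "('a \<times> 'b \<Rightarrow> real) \<Rightarrow> 'a set \<Rightarrow> 'b set \<Rightarrow> 'a \<Rightarrow> ereal" where
  "Phi f X Y x = ereal (SUP y'\<in>Y. f (x, y')) + convex_indicator X x"

definition opt_stationary ::
    "('a::real_normed_vector \<times> 'b \<Rightarrow> real) \<Rightarrow> 'a set \<Rightarrow> 'b set \<Rightarrow> real \<Rightarrow> real \<Rightarrow> 'a \<Rightarrow> bool" where
  "opt_stationary f X Y l \<epsilon> x \<longleftrightarrow>
     x \<in> X \<and> norm (prox (1 / (2 * l)) (Phi f X Y) x - x) \<le> \<epsilon> / (2 * l)"

definition F_reg ::
    "('a::real_normed_vector \<times> 'b::real_normed_vector \<Rightarrow> real) \<Rightarrow> real \<Rightarrow> real \<Rightarrow> 'a \<Rightarrow> 'a \<times> 'b \<Rightarrow> real"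
  where
  "F_reg f rx ry z = (\<lambda>(x, y). f (x, y) + rx / 2 * (norm (x - z))\<^sup>2 - ry / 2 * (norm y)\<^sup>2)"

text \<open>\<open>closest_point S\<close> is the Euclidean projection onto a nonempty closed convex set \<open>S\<close>.
  The starting pair is feasible; \<open>z 0\<close> is an arbitrary vector.\<close>

definition perturbed_smoothed_gda ::
    "('a::euclidean_space \<times> 'b::euclidean_space \<Rightarrow> real) \<Rightarrow> 'a set \<Rightarrow> 'b set \<Rightarrow> real \<Rightarrow>
     (nat \<Rightarrow> real) \<Rightarrow> (nat \<Rightarrow> real) \<Rightarrow> (nat \<Rightarrow> real) \<Rightarrow> (nat \<Rightarrow> real) \<Rightarrow>
     (nat \<Rightarrow> 'a) \<Rightarrow> (nat \<Rightarrow> 'b) \<Rightarrow> (nat \<Rightarrow> 'a) \<Rightarrow> bool" where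
  "perturbed_smoothed_gda f X Y rx ry c \<alpha> \<beta> x y z \<longleftrightarrow>
     x 0 \<in> X \<and> y 0 \<in> Y \<and>
     (\<forall>t. x (Suc t) = closest_point X (x t - c t *\<^sub>R grad_x (F_reg f rx (ry t) (z t)) (x t) (y t)) \<and>
          y (Suc t) = closest_point Y (y t + \<alpha> t *\<^sub>R grad_y (F_reg f rx (ry t) (z t)) (x (Suc t)) (y t)) \<and>
          z (Suc t) = z t + \<beta> t *\<^sub>R (x (Suc t) - z t))"

text \<open>\<open>u = \<Theta>(v)\<close> with the hidden constants \<open>k\<close>, \<open>K\<close> displayed.\<close>

definition theta_with :: "real \<Rightarrow> real \<Rightarrow> real \<Rightarrow> real \<Rightarrow> bool" where
  "theta_with k K u v \<longleftrightarrow> k * v \<le> u \<and> u \<le> K * v"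

definition omega :: "real \<Rightarrow> real \<Rightarrow> real \<Rightarrow> real \<Rightarrow> real" where
  "omega l rx r \<alpha> =
     1 / sqrt r * (((rx - l - r) + \<alpha> * (l + r) * (3 * rx - 2 * l - 2 * r)) /
                   (\<alpha> * (rx - l - r) powr (3 / 2)))"

text \<open>One pair \<open>k\<close>, \<open>K\<close> serves all the \<open>\<Theta>\<close> conditions: different hidden constants can be
  replaced by their minimum and maximum.\<close>

definition step_size_conditions ::
    "real \<Rightarrow> real \<Rightarrow> real \<Rightarrow> real \<Rightarrow> (nat \<Rightarrow> real) \<Rightarrow> (nat \<Rightarrow> real) \<Rightarrow> (nat \<Rightarrow> real) \<Rightarrow> (nat \<Rightarrow> real) \<Rightarrow> bool"
  where
  "step_size_conditions k K l rx ry c \<alpha> \<beta> \<longleftrightarrow>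
     theta_with k K rx l \<and> rx > 3 * l \<and>
     (\<forall>t. ry t > 0 \<and>
       theta_with k K (\<alpha> t) (1 / l) \<and> 0 < \<alpha> t \<and>
       \<alpha> t \<le> min (1 / (11 * (l + ry t)))
                 ((c t)\<^sup>2 * (rx - l - ry t)\<^sup>2 /
                  (4 * (l + ry t) * (1 + c t * (rx - l - ry t))\<^sup>2)) \<and>
       theta_with k K (c t) (1 / l) \<and> 0 < c t \<and> c t < 1 / (rx + l + ry t) \<and>
       0 < \<beta> t \<and>
       \<beta> t \<le> min (1 / 36) ((rx - l - ry t)\<^sup>2 / (384 * rx * (rx + l + ry t)\<^sup>2)) \<and>
       theta_with k K (\<beta> t) (ry t / l) \<and>
       \<beta> t \<le> 1 / (384 * rx * \<alpha> t * (omega l rx (ry t) (\<alpha> t))\<^sup>2))"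

definition primal_reg ::
    "('a \<times> 'b::real_normed_vector \<Rightarrow> real) \<Rightarrow> 'b set \<Rightarrow> real \<Rightarrow> 'a \<Rightarrow> real" where
  "primal_reg f Y r x = (SUP y\<in>Y. f (x, y) - r / 2 * (norm y)\<^sup>2)"

definition Psi2 ::
    "('a::real_normed_vector \<times> 'b::real_normed_vector \<Rightarrow> real) \<Rightarrow> 'a set \<Rightarrow> 'b set \<Rightarrow>
     real \<Rightarrow> real \<Rightarrow> 'a \<Rightarrow> 'b \<Rightarrow> 'a \<Rightarrow> real" where
  "Psi2 f X Y rx r x y z =
     F_reg f rx r z (x, y) - 2 * (INF x'\<in>X. F_reg f rx r z (x', y))
       + 2 * (INF x'\<in>X. SUP y'\<in>Y. F_reg f rx r z (x', y'))"

definition initial_gap ::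
    "('a::real_normed_vector \<times> 'b::real_normed_vector \<Rightarrow> real) \<Rightarrow> 'a set \<Rightarrow> 'b set \<Rightarrow>
     real \<Rightarrow> real \<Rightarrow> 'a \<Rightarrow> 'b \<Rightarrow> 'a \<Rightarrow> real" where
  "initial_gap f X Y rx r x y z = Psi2 f X Y rx r x y z - (INF x\<in>X. primal_reg f Y r x)"

text \<open>The only extremum in the gap that can fail to be finite is the infimum of \<open>primal_reg\<close>
  over \<open>X\<close>: suprema are over the compact set \<open>Y\<close>, and the other infima are of functions that are
  strongly convex on \<open>X\<close> because \<open>rx > l\<close>.\<close>

definition gap_finite ::
    "('a \<times> 'b::real_normed_vector \<Rightarrow> real) \<Rightarrow> 'a set \<Rightarrow> 'b set \<Rightarrow> real \<Rightarrow> bool" where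
  "gap_finite f X Y r \<longleftrightarrow> bdd_below (primal_reg f Y r ` X)"

end

theory Submission
  imports Defs
begin

text \<open>Write \<open>F(x,y,z)\<close> for the regularised objective, \<open>d(y,z)\<close> for its minimum over \<open>x\<close>, attained at
  \<open>x(y,z)\<close>, and \<open>P(z)\<close> for its minimax value. The Lyapunov function \<open>\<Psi> = F - 2 d + 2 P\<close> decreases in
  every iteration by a multiple of the squared step lengths: the \<open>x\<close>-step lowers \<open>F\<close>, the \<open>y\<close>-step
  raises \<open>d\<close>, which counts twice, about as much as \<open>F\<close>, and the \<open>z\<close>-step lowers \<open>F\<close> by an amount that pays for the
  change of \<open>P - d\<close>. That change is governed by the distance from \<open>x(y,z)\<close> to the saddle point, which
  strong convexity in \<open>x\<close> and the \<open>r/2\<close>-regularisation in \<open>y\<close> bound by the residual of the \<open>y\<close>-step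
  divided by \<open>sqrt r\<close>; this forces \<open>\<beta> = O(r/l)\<close>. As \<open>\<Psi>\<close> is at least the optimal value, some
  iteration makes little progress, and its residuals certify stationarity of the next iterate. All
  derivative estimates concern \<open>F\<close> itself, so no differentiability of \<open>d\<close> or \<open>P\<close> is needed.\<close>

section \<open>Smooth functions on convex sets\<close>

text \<open>Replaces a limit \<open>s\<close> to 0: comparisons along a segment, whose remainder is
  quadratic in \<open>s\<close>, become first-order conditions. If \<open>a\<close> were positive,
  the choice \<open>s = a / (2 * b)\<close> would give \<open>a \<le> a / 2\<close>.\<close>

lemma nonpos_if_le_scaled:
  fixes a b :: real
  assumes "\<And>s. 0 < s \<Longrightarrow> s \<le> 1 \<Longrightarrow> a \<le> s * b"
  shows "a \<le> 0"
proof (rule ccontr)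
  assume "\<not> a \<le> 0"
  hence a: "a > 0" by simp
  have b: "a \<le> b" using assms[of 1] by simp
  have "a \<le> (a / (2 * b)) * b" using a b by (intro assms) (auto simp: field_simps)
  thus False using a b by simp
qed

lemma norm_sq_shift:
  fixes x x' z :: "'v::real_inner"
  shows "(norm (x' - z))\<^sup>2 = (norm (x - z))\<^sup>2 + 2 * ((x - z) \<bullet> (x' - x)) + (norm (x' - x))\<^sup>2"
  by (simp add: power2_norm_eq_inner inner_diff_left inner_diff_right inner_commute)

lemma grad_eqI:
  assumes "GDERIV g u :> D"
  shows "grad g u = D"
  unfolding grad_def
proof (rule the_equality[where a = D])
  show "GDERIV g u :> D" by fact
  fix D' assume "GDERIV g u :> D'"
  hence "(\<lambda>h. h \<bullet> D') = (\<lambda>h. h \<bullet> D)"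
    using assms has_derivative_unique unfolding gderiv_def by blast
  thus "D' = D" by (metis inner_commute vector_eq_rdot)
qed

text \<open>Riesz representation in coordinates: a linear functional is the inner product with the
  vector whose coordinates are its values on the basis.\<close>

lemma GDERIV_grad:
  fixes g :: "'v::euclidean_space \<Rightarrow> real"
  assumes "g differentiable (at u)"
  shows "GDERIV g u :> grad g u"
proof -
  obtain g' where g': "(g has_derivative g') (at u)" using assms unfolding differentiable_def by blast
  interpret g': bounded_linear g' using g' by (rule has_derivative_bounded_linear)
  have "g' h = h \<bullet> (\<Sum>b\<in>Basis. g' b *\<^sub>R b)" for h
  proof -
    have "g' h = g' (\<Sum>b\<in>Basis. (h \<bullet> b) *\<^sub>R b)" by (simp add: euclidean_representation)
    also have "\<dots> = (\<Sum>b\<in>Basis. (h \<bullet> b) * g' b)" by (simp add: g'.sum g'.scaleR)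
    finally show ?thesis by (simp add: inner_sum_right mult.commute)
  qed
  hence "g' = (\<lambda>h. h \<bullet> (\<Sum>b\<in>Basis. g' b *\<^sub>R b))" by (rule ext)
  hence "GDERIV g u :> (\<Sum>b\<in>Basis. g' b *\<^sub>R b)" using g' unfolding gderiv_def by metis
  thus ?thesis using grad_eqI by metis
qed

text \<open>The gradient is controlled on \<open>S\<close> only, so everything happens on the
  segment from \<open>x\<close> to \<open>w\<close>: subtracting the quadratic model from
  \<open>g\<close> leaves \<open>\<phi>\<close>, whose derivative is nonpositive by
  Cauchy-Schwarz.\<close>

lemma lipschitz_gradient_upper:
  fixes g :: "'v::euclidean_space \<Rightarrow> real"
  assumes S: "convex S" and g: "\<And>u. u \<in> S \<Longrightarrow> GDERIV g u :> G u"
    and lip: "\<And>u v. u \<in> S \<Longrightarrow> v \<in> S \<Longrightarrow> norm (G u - G v) \<le> L * norm (u - v)"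
    and x: "x \<in> S" and w: "w \<in> S"
  shows "g w - g x - G x \<bullet> (w - x) \<le> L / 2 * (norm (w - x))\<^sup>2"
proof -
  define p where "p s = x + s *\<^sub>R (w - x)" for s :: real
  have pS: "p s \<in> S" if "0 \<le> s" "s \<le> 1" for s
    using convexD_alt[OF S x w that] by (simp add: p_def algebra_simps)
  define \<phi> where "\<phi> s = g (p s) - s * (G x \<bullet> (w - x)) - L / 2 * (norm (w - x))\<^sup>2 * s\<^sup>2" for s
  have "\<phi> 1 \<le> \<phi> 0"
  proof (rule DERIV_nonpos_imp_nonincreasing[of 0 1])
    fix s :: real assume s: "0 \<le> s" "s \<le> 1"
    have "(g has_derivative (\<lambda>h. h \<bullet> G (p s))) (at (p s))"
      using g[OF pS[OF s]] by (simp add: gderiv_def)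
    moreover have "(p has_derivative (\<lambda>t. t *\<^sub>R (w - x))) (at s)"
      unfolding p_def by (auto intro!: derivative_eq_intros)
    ultimately have "((\<lambda>s. g (p s)) has_derivative (\<lambda>t. (t *\<^sub>R (w - x)) \<bullet> G (p s))) (at s)"
      using has_derivative_compose by fast
    hence 1: "((\<lambda>s. g (p s)) has_real_derivative ((w - x) \<bullet> G (p s))) (at s)"
      unfolding has_field_derivative_def by (simp add: mult_commute_abs)
    have D: "(\<phi> has_real_derivative
       ((w - x) \<bullet> G (p s) - G x \<bullet> (w - x) - L / 2 * (norm (w - x))\<^sup>2 * (2 * s))) (at s)"
      unfolding \<phi>_def by (rule derivative_eq_intros 1 refl | simp)+
    have "(w - x) \<bullet> G (p s) - G x \<bullet> (w - x) = (G (p s) - G x) \<bullet> (w - x)"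
      by (simp only: inner_diff_left[of "G (p s)"] inner_commute[of "w - x"])
    also have "\<dots> \<le> norm (G (p s) - G x) * norm (w - x)" by (rule norm_cauchy_schwarz)
    also have "\<dots> \<le> (L * norm (p s - x)) * norm (w - x)"
      by (intro mult_right_mono lip pS s x) auto
    also have "\<dots> = L / 2 * (norm (w - x))\<^sup>2 * (2 * s)"
      using s by (simp add: p_def power2_eq_square)
    finally show "\<exists>y. (\<phi> has_real_derivative y) (at s) \<and> y \<le> 0" using D by force
  qed simp
  thus ?thesis by (simp add: \<phi>_def p_def)
qed

lemma lipschitz_gradient_bound:
  fixes g :: "'v::euclidean_space \<Rightarrow> real"
  assumes S: "convex S" and g: "\<And>u. u \<in> S \<Longrightarrow> GDERIV g u :> G u"
    and lip: "\<And>u v. u \<in> S \<Longrightarrow> v \<in> S \<Longrightarrow> norm (G u - G v) \<le> L * norm (u - v)"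
    and x: "x \<in> S" and w: "w \<in> S"
  shows "\<bar>g w - g x - G x \<bullet> (w - x)\<bar> \<le> L / 2 * (norm (w - x))\<^sup>2"
proof -
  have "g w - g x - G x \<bullet> (w - x) \<le> L / 2 * (norm (w - x))\<^sup>2"
    by (rule lipschitz_gradient_upper[OF S g lip x w])
  moreover have "- g w - - g x - (- G x) \<bullet> (w - x) \<le> L / 2 * (norm (w - x))\<^sup>2"
  proof (rule lipschitz_gradient_upper[OF S _ _ x w])
    show "GDERIV (\<lambda>u. - g u) u :> - G u" if "u \<in> S" for u by (rule GDERIV_minus[OF g[OF that]])
    show "norm (- G u - - G v) \<le> L * norm (u - v)" if "u \<in> S" "v \<in> S" for u v
      using lip[OF that] by (metis minus_diff_minus norm_minus_cancel)
  qed
  ultimately show ?thesis unfolding inner_minus_left abs_le_iff by linarith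
qed

section \<open>The regularised saddle-point problem\<close>

locale smooth_minimax =
  fixes f :: "'a::euclidean_space \<times> 'b::euclidean_space \<Rightarrow> real" and X Y l
  assumes problem: "minimax_problem f X Y l"
begin

lemma X_ne: "X \<noteq> {}" and X_closed: "closed X" and X_convex: "convex X"
  and Y_ne: "Y \<noteq> {}" and Y_compact: "compact Y" and Y_convex: "convex Y" and zero_Y: "0 \<in> Y"
  and l_pos: "l > 0"
  using problem by (auto simp: minimax_problem_def)

lemma Y_closed: "closed Y" using Y_compact by (rule compact_imp_closed)

lemma f_has_derivative: "f differentiable (at u)"
  using problem unfolding minimax_problem_def continuously_differentiable_def by blast

lemma f_continuous: "continuous_on S f"
  by (meson f_has_derivative continuous_at_imp_continuous_on differentiable_imp_continuous_within)

lemma gx_lip: "x \<in> X \<Longrightarrow> x' \<in> X \<Longrightarrow> y \<in> Y \<Longrightarrow> y' \<in> Y \<Longrightarrow>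
    norm (grad_x f x y - grad_x f x' y') \<le> l * (norm (x - x') + norm (y - y'))"
  and gy_lip: "x \<in> X \<Longrightarrow> x' \<in> X \<Longrightarrow> y \<in> Y \<Longrightarrow> y' \<in> Y \<Longrightarrow>
    norm (grad_y f x y - grad_y f x' y') \<le> l * (norm (x - x') + norm (y - y'))"
  using problem by (auto simp: minimax_problem_def l_smooth_on_def)

lemma f_concave: "x \<in> X \<Longrightarrow> concave_on Y (\<lambda>y. f (x, y))"
  using problem by (simp add: minimax_problem_def)

section \<open>Partial gradients and quadratic models of \<open>f\<close>\<close>

lemma GDERIV_x: "GDERIV (\<lambda>x'. f (x', y)) x :> grad_x f x y"
proof -
  have "(f \<circ> (\<lambda>x'. (x', y))) differentiable (at x)"
    by (intro differentiable_chain_at f_has_derivative)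
      (auto simp: differentiable_def intro!: exI derivative_eq_intros)
  hence "(\<lambda>x'. f (x', y)) differentiable (at x)" by (simp add: o_def)
  thus ?thesis unfolding grad_x_def by (rule GDERIV_grad)
qed

lemma GDERIV_y: "GDERIV (\<lambda>y'. f (x, y')) y :> grad_y f x y"
proof -
  have "(f \<circ> (\<lambda>y'. (x, y'))) differentiable (at y)"
    by (intro differentiable_chain_at f_has_derivative)
      (auto simp: differentiable_def intro!: exI derivative_eq_intros)
  hence "(\<lambda>y'. f (x, y')) differentiable (at y)" by (simp add: o_def)
  thus ?thesis unfolding grad_y_def by (rule GDERIV_grad)
qed

lemma f_x_bound:
  assumes "x \<in> X" "x' \<in> X" "y \<in> Y"
  shows "\<bar>f (x', y) - f (x, y) - grad_x f x y \<bullet> (x' - x)\<bar> \<le> l / 2 * (norm (x' - x))\<^sup>2"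
  using assms gx_lip[of _ _ y y]
  by (intro lipschitz_gradient_bound[OF X_convex, where G = "\<lambda>x. grad_x f x y"] GDERIV_x) auto

lemma f_y_bound:
  assumes "x \<in> X" "y \<in> Y" "y' \<in> Y"
  shows "\<bar>f (x, y') - f (x, y) - grad_y f x y \<bullet> (y' - y)\<bar> \<le> l / 2 * (norm (y' - y))\<^sup>2"
  using assms gy_lip[of x x]
  by (intro lipschitz_gradient_bound[OF Y_convex, where G = "\<lambda>y. grad_y f x y"] GDERIV_y) auto

text \<open>Concavity is given through chords in \<open>Y\<close>. The chord inequality at the
  fraction \<open>s\<close>, the smoothness bound at that point and division by \<open>s\<close>
  leave the tangent inequality up to a term of order \<open>s\<close>.\<close>

lemma f_y_tangent:
  assumes x: "x \<in> X" and y: "y \<in> Y" and y': "y' \<in> Y"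
  shows "f (x, y') \<le> f (x, y) + grad_y f x y \<bullet> (y' - y)"
proof -
  have "f (x, y') - f (x, y) - grad_y f x y \<bullet> (y' - y) \<le> 0"
  proof (rule nonpos_if_le_scaled)
    fix s :: real assume s: "0 < s" "s \<le> 1"
    define w where "w = (1 - s) *\<^sub>R y + s *\<^sub>R y'"
    have w: "w \<in> Y" unfolding w_def using s by (intro convexD_alt[OF Y_convex y y']) auto
    have wy: "w - y = s *\<^sub>R (y' - y)" by (simp add: w_def algebra_simps)
    have "(1 - s) * f (x, y) + s * f (x, y') \<le> f (x, w)"
      unfolding w_def using f_concave[OF x] s y y' by (intro concave_onD) auto
    also have "\<dots> \<le> f (x, y) + grad_y f x y \<bullet> (w - y) + l / 2 * (norm (w - y))\<^sup>2"
      using f_y_bound[OF x y w] by linarith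
    also have "\<dots> = f (x, y) + s * (grad_y f x y \<bullet> (y' - y)) + s * (s * (l / 2 * (norm (y' - y))\<^sup>2))"
      by (simp add: wy power_mult_distrib power2_eq_square)
    finally have "s * (f (x, y') - f (x, y) - grad_y f x y \<bullet> (y' - y))
        \<le> s * (s * (l / 2 * (norm (y' - y))\<^sup>2))" by (simp add: algebra_simps)
    thus "f (x, y') - f (x, y) - grad_y f x y \<bullet> (y' - y) \<le> s * (l / 2 * (norm (y' - y))\<^sup>2)"
      using s by simp
  qed
  thus ?thesis by simp
qed

section \<open>Curvature of the regularised objective\<close>

abbreviation "F \<equiv> F_reg f"

text \<open>The partial gradients of \<open>F\<close> in closed form. The first is free of
  \<open>r\<close>, the second of \<open>rx\<close> and \<open>z\<close>, so these arguments are
  dropped.\<close>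

definition gx where "gx rx z x y = grad_x f x y + rx *\<^sub>R (x - z)"

definition gy where "gy r x y = grad_y f x y - r *\<^sub>R y"

lemma F_eq: "F rx r z (x, y) = f (x, y) + rx / 2 * (norm (x - z))\<^sup>2 - r / 2 * (norm y)\<^sup>2"
  by (simp add: F_reg_def)

lemma GDERIV_half_norm_sq: "GDERIV (\<lambda>u. a / 2 * (norm (u - z))\<^sup>2) u :> a *\<^sub>R (u - z)"
  unfolding gderiv_def power2_norm_eq_inner
  by (auto intro!: derivative_eq_intros simp: inner_commute)

lemma grad_x_F: "grad_x (F rx r z) x y = gx rx z x y"
  unfolding grad_x_def gx_def F_eq
  using GDERIV_diff[OF GDERIV_add[OF GDERIV_x GDERIV_half_norm_sq[of rx z]] GDERIV_const]
  by (intro grad_eqI) (simp add: grad_x_def)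

lemma grad_y_F: "grad_y (F rx r z) x y = gy r x y"
  unfolding grad_y_def gy_def F_eq
  using GDERIV_diff[OF GDERIV_add[OF GDERIV_y GDERIV_const] GDERIV_half_norm_sq[of r 0]]
  by (intro grad_eqI) (simp add: grad_y_def)

text \<open>The proximal term adds curvature \<open>rx\<close> to that of \<open>f\<close> in
  \<open>x\<close>, which is at least \<open>- l\<close>; for \<open>rx > l\<close> this is strong
  convexity.\<close>

lemma F_x_lower:
  assumes "x \<in> X" "x' \<in> X" "y \<in> Y"
  shows "F rx r z (x, y) + gx rx z x y \<bullet> (x' - x) + (rx - l) / 2 * (norm (x' - x))\<^sup>2
    \<le> F rx r z (x', y)"
  using f_x_bound[OF assms]
  unfolding F_eq gx_def norm_sq_shift[of x' z x] inner_add_left inner_scaleR_left abs_le_iff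
  by (simp add: field_simps)

lemma F_x_upper:
  assumes "x \<in> X" "x' \<in> X" "y \<in> Y"
  shows "F rx r z (x', y)
    \<le> F rx r z (x, y) + gx rx z x y \<bullet> (x' - x) + (rx + l) / 2 * (norm (x' - x))\<^sup>2"
  using f_x_bound[OF assms]
  unfolding F_eq gx_def norm_sq_shift[of x' z x] inner_add_left inner_scaleR_left abs_le_iff
  by (simp add: field_simps)

text \<open>The regularisation makes the concave \<open>f\<close> strongly concave in
  \<open>y\<close> with modulus \<open>r\<close>; this modulus is the source of the factor
  \<open>1 / sqrt r\<close> in the rates.\<close>

lemma F_y_upper:
  assumes "x \<in> X" "y \<in> Y" "y' \<in> Y"
  shows "F rx r z (x, y') \<le> F rx r z (x, y) + gy r x y \<bullet> (y' - y) - r / 2 * (norm (y' - y))\<^sup>2"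
  using f_y_tangent[OF assms] norm_sq_shift[of y' 0 y]
  unfolding F_eq gy_def inner_diff_left inner_scaleR_left
  by (simp add: field_simps)

lemma F_y_lower:
  assumes "x \<in> X" "y \<in> Y" "y' \<in> Y"
  shows "F rx r z (x, y) + gy r x y \<bullet> (y' - y) - (l + r) / 2 * (norm (y' - y))\<^sup>2
    \<le> F rx r z (x, y')"
  using f_y_bound[OF assms] norm_sq_shift[of y' 0 y]
  unfolding F_eq gy_def inner_diff_left inner_scaleR_left abs_le_iff
  by (simp add: field_simps)

lemma F_continuous: "continuous_on S (F rx r z)"
proof -
  have "F rx r z = (\<lambda>p. f p + rx / 2 * (norm (fst p - z))\<^sup>2 - r / 2 * (norm (snd p))\<^sup>2)"
    by (auto simp: F_reg_def)
  thus ?thesis by (simp only:) (intro continuous_intros f_continuous)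
qed

section \<open>The inner minimiser and saddle points\<close>

lemma ex_minimizer:
  assumes rx: "rx > l" and y: "y \<in> Y"
  shows "\<exists>x\<in>X. \<forall>w\<in>X. F rx 0 z (x, y) \<le> F rx 0 z (w, y)"
proof -
  obtain x0 where x0: "x0 \<in> X" using X_ne by blast
  define g where "g = gx rx z x0 y"
  \<comment> \<open>The radius at which quadratic growth overtakes the linear term:
    \<open>(rx - l) / 2 * R = norm g\<close>. Outside the ball no point beats \<open>x0\<close>, so
    a minimiser over the compact part is global.\<close>
  define R where "R = 2 * norm g / (rx - l)"
  have far: "F rx 0 z (x0, y) \<le> F rx 0 z (w, y)" if w: "w \<in> X" "dist x0 w > R" for w
  proof -
    have n: "norm (w - x0) \<ge> R" using w by (simp add: dist_norm norm_minus_commute)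
    have "norm g * norm (w - x0) = (rx - l) / 2 * R * norm (w - x0)"
      using rx by (simp add: R_def)
    also have "\<dots> \<le> (rx - l) / 2 * norm (w - x0) * norm (w - x0)"
      using rx n by (intro mult_right_mono mult_left_mono) auto
    finally have "- (g \<bullet> (w - x0)) \<le> (rx - l) / 2 * (norm (w - x0))\<^sup>2"
      using norm_cauchy_schwarz[of "- g" "w - x0"] by (simp add: power2_eq_square)
    thus ?thesis using F_x_lower[OF x0 w(1) y, of rx 0 z] by (simp add: g_def)
  qed
  let ?K = "X \<inter> cball x0 R"
  have R0: "R \<ge> 0" using rx by (simp add: R_def)
  have "\<exists>x\<in>?K. \<forall>w\<in>?K. F rx 0 z (x, y) \<le> F rx 0 z (w, y)"
  proof (rule continuous_attains_inf)
    show "compact ?K" using X_closed by (intro closed_Int_compact) auto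
    show "?K \<noteq> {}" using x0 R0 by auto
    show "continuous_on ?K (\<lambda>w. F rx 0 z (w, y))"
      by (rule continuous_on_compose2[OF F_continuous[of UNIV]]) (auto intro!: continuous_intros)
  qed
  then obtain x where x: "x \<in> ?K" "\<And>w. w \<in> ?K \<Longrightarrow> F rx 0 z (x, y) \<le> F rx 0 z (w, y)" by blast
  have "F rx 0 z (x, y) \<le> F rx 0 z (w, y)" if "w \<in> X" for w
    using that x(2)[of w] x(2)[of x0] x0 R0 far[of w]
    by (cases "dist x0 w \<le> R") (auto intro: order_trans)
  thus ?thesis using x(1) by blast
qed

text \<open>The minimiser does not depend on the \<open>y\<close>-regularisation, hence the parameter \<open>0\<close>.\<close>

definition xarg where
  "xarg rx z y = (SOME x. x \<in> X \<and> (\<forall>w\<in>X. F rx 0 z (x, y) \<le> F rx 0 z (w, y)))"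

context
  fixes rx :: real
  assumes rx: "rx > l"
begin

lemma xarg_in: "y \<in> Y \<Longrightarrow> xarg rx z y \<in> X"
  and xarg_min0: "y \<in> Y \<Longrightarrow> w \<in> X \<Longrightarrow> F rx 0 z (xarg rx z y, y) \<le> F rx 0 z (w, y)"
  using someI_ex[of "\<lambda>x. x \<in> X \<and> (\<forall>w\<in>X. F rx 0 z (x, y) \<le> F rx 0 z (w, y))"]
    ex_minimizer[OF rx, of y z] unfolding xarg_def by blast+

lemma xarg_min: "y \<in> Y \<Longrightarrow> w \<in> X \<Longrightarrow> F rx r z (xarg rx z y, y) \<le> F rx r z (w, y)"
  using xarg_min0[of y w z] by (simp add: F_eq)

text \<open>First-order optimality: minimality is tested on the segment towards \<open>w\<close>,
  where \<open>F_x_upper\<close> bounds the change by a linear term plus one quadratic in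
  \<open>s\<close>.\<close>

lemma xarg_VI:
  assumes y: "y \<in> Y" and w: "w \<in> X"
  shows "0 \<le> gx rx z (xarg rx z y) y \<bullet> (w - xarg rx z y)"
proof -
  define x where "x = xarg rx z y"
  have x: "x \<in> X" using xarg_in[OF y] by (simp add: x_def)
  have "- (gx rx z x y \<bullet> (w - x)) \<le> 0"
  proof (rule nonpos_if_le_scaled)
    fix s :: real assume s: "0 < s" "s \<le> 1"
    define v where "v = (1 - s) *\<^sub>R x + s *\<^sub>R w"
    have v: "v \<in> X" unfolding v_def using s by (intro convexD_alt[OF X_convex x w]) auto
    have vx: "v - x = s *\<^sub>R (w - x)" by (simp add: v_def algebra_simps)
    have "0 \<le> gx rx z x y \<bullet> (v - x) + (rx + l) / 2 * (norm (v - x))\<^sup>2"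
      using F_x_upper[OF x v y, of rx 0 z] xarg_min[OF y v, of 0 z] by (simp add: x_def)
    also have "\<dots> = s * (gx rx z x y \<bullet> (w - x) + s * ((rx + l) / 2 * (norm (w - x))\<^sup>2))"
      unfolding vx inner_scaleR_right norm_scaleR power_mult_distrib
      by (simp add: power2_eq_square distrib_left mult_ac)
    finally show "- (gx rx z x y \<bullet> (w - x)) \<le> s * ((rx + l) / 2 * (norm (w - x))\<^sup>2)"
      using s by (simp add: zero_le_mult_iff)
  qed
  thus ?thesis by (simp add: x_def)
qed

lemma xarg_growth:
  assumes "y \<in> Y" "w \<in> X"
  shows "F rx r z (xarg rx z y, y) + (rx - l) / 2 * (norm (w - xarg rx z y))\<^sup>2 \<le> F rx r z (w, y)"
  using F_x_lower[OF xarg_in[OF assms(1)] assms(2,1), of rx r z z] xarg_VI[OF assms, of z] by linarith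

text \<open>Strong convexity makes the gradient in \<open>x\<close> strongly monotone, and the two
  optimality conditions then bound the squared distance of the minimisers by the effect of changing
  \<open>(y, z)\<close> on the gradient at one fixed point \<open>b\<close>.\<close>

lemma xarg_lipschitz:
  assumes y: "y \<in> Y" and y': "y' \<in> Y"
  shows "(rx - l) * norm (xarg rx z y - xarg rx z' y') \<le> l * norm (y - y') + rx * norm (z - z')"
proof -
  define a b where "a = xarg rx z y" and "b = xarg rx z' y'"
  have a: "a \<in> X" and b: "b \<in> X" using xarg_in y y' by (auto simp: a_def b_def)
  have n: "norm (b - a) = norm (a - b)" by (rule norm_minus_commute)
  have "F rx 0 z (a, y) + gx rx z a y \<bullet> (b - a) + (rx - l) / 2 * (norm (a - b))\<^sup>2 \<le> F rx 0 z (b, y)"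
    using F_x_lower[OF a b y, of rx 0 z] by (simp add: n)
  moreover have "F rx 0 z (b, y) + gx rx z b y \<bullet> (a - b) + (rx - l) / 2 * (norm (a - b))\<^sup>2 \<le> F rx 0 z (a, y)"
    using F_x_lower[OF b a y, of rx 0 z] .
  moreover have "0 \<le> gx rx z a y \<bullet> (b - a)" "0 \<le> gx rx z' b y' \<bullet> (a - b)"
    using xarg_VI[OF y b, of z] xarg_VI[OF y' a, of z'] by (auto simp: a_def b_def)
  ultimately have "(rx - l) * (norm (a - b))\<^sup>2 \<le> (gx rx z' b y' - gx rx z b y) \<bullet> (a - b)"
    by (simp add: inner_diff_left)
  also have "\<dots> \<le> norm (gx rx z' b y' - gx rx z b y) * norm (a - b)" by (rule norm_cauchy_schwarz)
  also have "gx rx z' b y' - gx rx z b y = (grad_x f b y' - grad_x f b y) + rx *\<^sub>R (z - z')"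
    by (simp add: gx_def algebra_simps)
  also have "norm \<dots> * norm (a - b) \<le> (l * norm (y - y') + rx * norm (z - z')) * norm (a - b)"
  proof (rule mult_right_mono)
    have "norm (grad_x f b y' - grad_x f b y) \<le> l * norm (y - y')"
      using gx_lip[OF b b y' y] by (simp add: norm_minus_commute)
    moreover have "norm (rx *\<^sub>R (z - z')) = rx * norm (z - z')" using rx l_pos by simp
    ultimately show "norm ((grad_x f b y' - grad_x f b y) + rx *\<^sub>R (z - z'))
       \<le> l * norm (y - y') + rx * norm (z - z')" by (metis add_mono norm_triangle_le order_refl)
  qed simp
  finally have *: "(rx - l) * norm (a - b) * norm (a - b)
      \<le> (l * norm (y - y') + rx * norm (z - z')) * norm (a - b)" by (simp add: power2_eq_square mult.assoc)
  show ?thesis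
  proof (cases "norm (a - b) = 0")
    case True
    thus ?thesis using rx l_pos by (simp add: a_def b_def)
  next
    case False
    hence "norm (a - b) > 0" by simp
    thus ?thesis using * by (simp add: a_def b_def)
  qed
qed

lemma xarg_continuous: "continuous_on Y (xarg rx z)"
proof (rule lipschitz_on_continuous_on[OF lipschitz_onI[of _ _ "l / (rx - l)"]])
  show "dist (xarg rx z y) (xarg rx z y') \<le> l / (rx - l) * dist y y'" if "y \<in> Y" "y' \<in> Y" for y y'
    using xarg_lipschitz[OF that, of z z] rx by (simp add: dist_norm field_simps)
  show "0 \<le> l / (rx - l)" using rx l_pos by simp
qed

text \<open>Minimax duality by hand: a maximiser of the dual function, paired with its inner
  minimiser, is a saddle point. The case \<open>r = 0\<close> is included because the proximal point
  of the unperturbed problem is described by it.\<close>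

lemma ex_saddle:
  assumes r: "r \<ge> 0"
  shows "\<exists>y\<in>Y. \<forall>y'\<in>Y. F rx r z (xarg rx z y, y') \<le> F rx r z (xarg rx z y, y)"
proof -
  have "\<exists>y\<in>Y. \<forall>y'\<in>Y. F rx r z (xarg rx z y', y') \<le> F rx r z (xarg rx z y, y)"
    by (rule continuous_attains_sup[OF Y_compact Y_ne])
      (auto intro!: continuous_on_compose2[OF F_continuous[of UNIV]] continuous_intros xarg_continuous)
  then obtain y where y: "y \<in> Y"
    and ymax: "\<And>y'. y' \<in> Y \<Longrightarrow> F rx r z (xarg rx z y', y') \<le> F rx r z (xarg rx z y, y)" by blast
  have "F rx r z (xarg rx z y, y') \<le> F rx r z (xarg rx z y, y)" if y': "y' \<in> Y" for y'
  proof -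
    \<comment> \<open>Points of \<open>Y\<close> tending to \<open>y\<close> from the direction of
      \<open>y'\<close>. Their inner minimisers converge to that of \<open>y\<close>, so the bound
      is proved at them first.\<close>
    define w where "w n = (1 - 1 / Suc n) *\<^sub>R y + (1 / Suc n) *\<^sub>R y'" for n
    have w: "w n \<in> Y" for n unfolding w_def by (intro convexD_alt[OF Y_convex y y']) auto
    have step: "F rx r z (xarg rx z (w n), y') \<le> F rx r z (xarg rx z y, y)" for n
    proof -
      define s :: real where "s = 1 / Suc n"
      have s: "0 < s" "s \<le> 1" by (auto simp: s_def)
      define x where "x = xarg rx z (w n)"
      have x: "x \<in> X" using xarg_in[OF w] by (simp add: x_def)
      define G where "G = gy r x (w n)"
      have yw: "y - w n = s *\<^sub>R (y - y')" "y' - w n = - ((1 - s) *\<^sub>R (y - y'))"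
        unfolding w_def s_def[symmetric] by (simp_all add: algebra_simps)
      have "r / 2 * q\<^sup>2 \<ge> 0" for q using r by simp
      hence "F rx r z (x, y) \<le> F rx r z (x, w n) + G \<bullet> (y - w n)"
            "F rx r z (x, y') \<le> F rx r z (x, w n) + G \<bullet> (y' - w n)"
        using F_y_upper[OF x w y, of rx r z n] F_y_upper[OF x w y', of rx r z n]
        unfolding G_def by (smt (verit))+
      hence 1: "F rx r z (x, y) \<le> F rx r z (x, w n) + s * (G \<bullet> (y - y'))"
            "F rx r z (x, y') \<le> F rx r z (x, w n) - (1 - s) * (G \<bullet> (y - y'))" unfolding yw by simp_all
      \<comment> \<open>Both tangent bounds have base point \<open>w n\<close>; with weights
        \<open>1 - s\<close> and \<open>s\<close> the gradient terms cancel.\<close>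
      have "(1 - s) * F rx r z (x, y) + s * F rx r z (x, y') \<le> F rx r z (x, w n)"
        using mult_left_mono[OF 1(1), of "1 - s"] mult_left_mono[OF 1(2), of s] s
        by (simp add: algebra_simps)
      also have "\<dots> \<le> F rx r z (xarg rx z y, y)" unfolding x_def by (rule ymax[OF w])
      finally have "s * F rx r z (x, y') \<le> F rx r z (xarg rx z y, y) - (1 - s) * F rx r z (x, y)" by simp
      \<comment> \<open>Inner minimality at \<open>y\<close> removes \<open>x\<close> with the
        favourable sign; what remains carries a common factor \<open>s\<close>.\<close>
      also have "\<dots> \<le> F rx r z (xarg rx z y, y) - (1 - s) * F rx r z (xarg rx z y, y)"
        using s xarg_min[OF y x, of r z] by (intro diff_left_mono mult_left_mono) auto
      finally show ?thesis using s by (simp add: algebra_simps x_def)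
    qed
    have "(\<lambda>n. 1 / real (Suc n)) \<longlonglongrightarrow> 0" by (rule LIMSEQ_Suc[OF lim_1_over_n])
    hence wl: "w \<longlonglongrightarrow> (1 - 0) *\<^sub>R y + 0 *\<^sub>R y'" unfolding w_def by (intro tendsto_intros)
    have "(\<lambda>n. xarg rx z (w n)) \<longlonglongrightarrow> xarg rx z y"
      using continuous_on_tendsto_compose[OF xarg_continuous, of w y] wl y w by simp
    hence "(\<lambda>n. F rx r z (xarg rx z (w n), y')) \<longlonglongrightarrow> F rx r z (xarg rx z y, y')"
      using F_continuous[of UNIV rx r z]
      by (intro continuous_on_tendsto_compose[where s = UNIV and f = "F rx r z"] tendsto_intros) auto
    thus ?thesis using step by (intro LIMSEQ_le_const2) auto
  qed
  thus ?thesis using y by blast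
qed

end

end

section \<open>Descent of the Lyapunov function\<close>

text \<open>Turns contraction towards a target into an error bound: \<open>B\<close> and
  \<open>A\<close> are the distances before and after a step of length \<open>d\<close>. If
  \<open>d < u * A\<close>, then \<open>B < (1 + u) * A\<close>, and the contraction would force
  \<open>1 \<le> 1 - u\<^sup>2\<close>.\<close>

lemma contraction_error_bound:
  fixes A B d u :: real
  assumes u: "0 < u" and A: "A \<ge> 0" and B: "0 \<le> B" "B \<le> A + d"
    and contr: "(1 + u) * A\<^sup>2 \<le> (1 - u) * B\<^sup>2"
  shows "u * A \<le> d"
proof (rule ccontr)
  assume "\<not> u * A \<le> d"
  hence d: "d < u * A" by simp
  hence A0: "A > 0" using A B by (smt (verit) mult_not_zero)
  have u1: "u \<le> 1"
  proof (rule ccontr)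
    assume "\<not> u \<le> 1"
    hence "(1 - u) * B\<^sup>2 \<le> 0" by (intro mult_nonpos_nonneg) auto
    moreover have "(1 + u) * A\<^sup>2 > 0" using u A0 by simp
    ultimately show False using contr by linarith
  qed
  have "B\<^sup>2 < (A * (1 + u))\<^sup>2" using B d by (intro power_strict_mono) (auto simp: algebra_simps)
  hence "(1 + u) * A\<^sup>2 \<le> (1 - u) * (A * (1 + u))\<^sup>2"
    using contr u1 by (smt (verit) mult_left_mono)
  also have "\<dots> = (1 + u) * A\<^sup>2 * (1 - u\<^sup>2)" by (simp add: power2_eq_square algebra_simps)
  finally have "(1 + u) * A\<^sup>2 * u\<^sup>2 \<le> 0" by (simp add: algebra_simps)
  moreover have "(1 + u) * A\<^sup>2 * u\<^sup>2 > 0" using u A0 by simp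
  ultimately show False by linarith
qed

text \<open>The scalar core of the descent. Here \<open>d\<close>, \<open>w\<close>,
  \<open>e\<close> are the lengths of \<open>x' - x\<close>, \<open>y' - y\<close>,
  \<open>x' - z\<close>; \<open>A\<close> and \<open>b\<close> are distances of \<open>x'\<close>
  and of the new inner minimiser from the old one, \<open>S\<close> is the distance of the new one
  from the saddle point, and \<open>V\<close> the dual residual. Every error is charged to
  \<open>E\<close>, \<open>W\<close> or \<open>Q\<close>, the squared steps in their natural
  scaling.\<close>

lemma descent_arithmetic:
  fixes A S V L b c d e l r rx w \<alpha> \<beta> \<mu> :: real
  assumes l: "0 < l" and r: "0 < r" and L: "L = l + r" and \<mu>: "\<mu> = rx - l" and rx: "3 * l < rx"
    and c: "0 < c" "c * (rx + l) \<le> 1"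
    and \<alpha>: "0 < \<alpha>" "11 * \<alpha> * L \<le> 1" "4 * \<alpha> * L \<le> (c * \<mu>)\<^sup>2"
    and \<beta>: "0 < \<beta>" "\<beta> \<le> 1 / 36" "384 * rx * \<beta> \<le> r * \<mu> * \<alpha>"
    and nonneg: "0 \<le> A" "0 \<le> b" "0 \<le> d" "0 \<le> e" "0 \<le> w" "0 \<le> S" "0 \<le> V"
    and A: "c * \<mu> * A \<le> d" and b: "\<mu> * b \<le> l * w"
    and S: "2 * r * \<mu> * S\<^sup>2 \<le> V\<^sup>2" and V: "V \<le> w / \<alpha> + L * w + l * (A + b)"
  shows "2 * l * (A + b) * w + L * w\<^sup>2 + 2 * rx * \<beta> * (3 / 2 * \<beta> * e + S) * e
      + d\<^sup>2 / (4 * c) + w\<^sup>2 / (8 * \<alpha>) + rx * \<beta> / 3 * e\<^sup>2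
    \<le> d\<^sup>2 / (2 * c) + w\<^sup>2 / \<alpha> + rx / 2 * (2 * \<beta> - \<beta>\<^sup>2) * e\<^sup>2"
proof -
  have \<mu>2: "2 * l < \<mu>" and rx0: "0 < rx" using rx \<mu> l by linarith+
  have lL: "l \<le> L" using L r by simp
  define W where "W = w\<^sup>2 / \<alpha>"
  have W0: "W \<ge> 0" using \<alpha> by (simp add: W_def)
  define E where "E = d\<^sup>2 / c"
  have E0: "E \<ge> 0" using c by (simp add: E_def)
  have bw: "2 * b \<le> w"
  proof -
    have "2 * l * b \<le> \<mu> * b" using \<mu>2 nonneg by (intro mult_right_mono) auto
    hence "l * (2 * b) \<le> l * w" using b by simp
    thus ?thesis using l by simp
  qed
  have Lw: "L * w\<^sup>2 \<le> W / 11"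
  proof -
    have "(11 * \<alpha> * L) * w\<^sup>2 \<le> 1 * w\<^sup>2" using \<alpha> by (intro mult_right_mono) auto
    thus ?thesis using \<alpha> by (simp add: W_def field_simps)
  qed
  have bterm: "2 * l * b * w \<le> W / 11"
  proof -
    have "l * ((2 * b) * w) \<le> l * (w * w)" using bw nonneg l by (intro mult_left_mono mult_right_mono) auto
    also have "\<dots> \<le> L * w\<^sup>2" using lL by (simp add: power2_eq_square mult_right_mono)
    finally show ?thesis using Lw by simp
  qed
  have cl: "4 * l * c \<le> 1"
  proof -
    have "c * (4 * l) \<le> c * (rx + l)" using c rx by (intro mult_left_mono) auto
    thus ?thesis using c(2) unfolding mult.commute[of "4 * l"] by linarith
  qed
  have lA: "\<alpha> * l\<^sup>2 * A\<^sup>2 \<le> E / 16"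
  proof -
    have "4 * \<alpha> * l * A\<^sup>2 \<le> (c * \<mu>)\<^sup>2 * A\<^sup>2"
    proof (rule mult_right_mono)
      have "4 * \<alpha> * l \<le> 4 * \<alpha> * L" using lL \<alpha> by simp
      thus "4 * \<alpha> * l \<le> (c * \<mu>)\<^sup>2" using \<alpha> by linarith
    qed simp
    also have "\<dots> = (c * \<mu> * A)\<^sup>2" by (simp add: power_mult_distrib)
    also have "\<dots> \<le> d\<^sup>2" using A nonneg c \<mu>2 l by (intro power_mono) auto
    finally have "(4 * \<alpha> * l * A\<^sup>2) * (4 * l * c) \<le> d\<^sup>2 * 1" using cl l c by (intro mult_mono) auto
    thus ?thesis using c by (simp add: E_def field_simps power2_eq_square)
  qed
  have Aterm: "2 * l * A * w \<le> W / 2 + E / 8"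
  proof -
    \<comment> \<open>Young's inequality, weighted to cost half of \<open>W\<close>; the rest is
      paid by the \<open>x\<close>-step through \<open>lA\<close>.\<close>
    have "0 \<le> (w - 2 * \<alpha> * l * A)\<^sup>2 / (2 * \<alpha>)" using \<alpha> by simp
    also have "\<dots> = W / 2 - 2 * l * A * w + 2 * (\<alpha> * l\<^sup>2 * A\<^sup>2)"
      using \<alpha> by (simp add: W_def field_simps power2_eq_square)
    finally show ?thesis using lA by linarith
  qed
  have V2: "\<alpha> * V\<^sup>2 \<le> 3 * W + E / 8"
  proof -
    have "11 * \<alpha> * (L * w) \<le> w"
      using mult_right_mono[OF \<alpha>(2) nonneg(5)] by (simp add: mult.assoc)
    moreover have "\<alpha> * (l * (2 * b)) \<le> \<alpha> * (L * w)"
      using bw lL nonneg l r L \<alpha> by (intro mult_left_mono mult_mono) auto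
    ultimately have "\<alpha> * (L * w + l * b) \<le> 1 / 5 * w" using nonneg
      by (simp add: distrib_left)
    hence "L * w + l * b \<le> 1 / 5 * (w / \<alpha>)" using \<alpha> by (simp add: field_simps)
    hence "V \<le> 6 / 5 * (w / \<alpha>) + l * A" using V by (simp add: algebra_simps)
    hence "V\<^sup>2 \<le> (6 / 5 * (w / \<alpha>) + l * A)\<^sup>2" using nonneg by (intro power_mono) auto
    also have "\<dots> \<le> 2 * (6 / 5 * (w / \<alpha>))\<^sup>2 + 2 * (l * A)\<^sup>2"
      using sum_squares_bound[of "6 / 5 * (w / \<alpha>)" "l * A"] by (simp add: power2_sum)
    finally have "\<alpha> * V\<^sup>2 \<le> \<alpha> * (2 * (6 / 5 * (w / \<alpha>))\<^sup>2 + 2 * (l * A)\<^sup>2)"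
      using \<alpha> by (intro mult_left_mono) auto
    also have "\<dots> = 72 / 25 * W + 2 * (\<alpha> * l\<^sup>2 * A\<^sup>2)"
      using \<alpha> by (simp add: W_def field_simps power2_eq_square)
    finally show ?thesis using lA W0 by linarith
  qed
  \<comment> \<open>The bound on \<open>\<beta>\<close> relative to \<open>r\<close> is spent here:
    it compensates the factor \<open>1 / r\<close> of the dual error bound.\<close>
  have Sterm: "2 * rx * \<beta> * S\<^sup>2 \<le> W / 128 + E / 3072"
  proof -
    have "(384 * rx * \<beta>) * (2 * S\<^sup>2) \<le> (r * \<mu> * \<alpha>) * (2 * S\<^sup>2)" using \<beta> by (intro mult_right_mono) auto
    also have "\<dots> = \<alpha> * (2 * r * \<mu> * S\<^sup>2)" by simp
    also have "\<dots> \<le> \<alpha> * V\<^sup>2" using S \<alpha> by (intro mult_left_mono) auto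
    finally have "384 * (2 * rx * \<beta> * S\<^sup>2) \<le> 3 * W + E / 8" using V2 by simp
    thus ?thesis by simp
  qed
  define Q where "Q = rx * \<beta> * e\<^sup>2"
  have Q0: "Q \<ge> 0" using rx0 \<beta> by (simp add: Q_def)
  have bQ: "\<beta> * Q \<le> Q / 36" using mult_right_mono[OF \<beta>(2) Q0] by simp
  have SQ: "2 * rx * \<beta> * S * e \<le> Q / 2 + 2 * rx * \<beta> * S\<^sup>2"
  proof -
    have "0 \<le> rx * \<beta> * (e - 2 * S)\<^sup>2 / 2" using rx0 \<beta> by simp
    thus ?thesis by (simp add: Q_def power2_eq_square algebra_simps)
  qed
  have 1: "2 * rx * \<beta> * (3 / 2 * \<beta> * e + S) * e = 3 * (\<beta> * Q) + 2 * rx * \<beta> * S * e"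
    by (simp add: Q_def power2_eq_square algebra_simps)
  have 2: "rx / 2 * (2 * \<beta> - \<beta>\<^sup>2) * e\<^sup>2 = Q - \<beta> * Q / 2"
    by (simp add: Q_def power2_eq_square algebra_simps)
  have 3: "2 * l * (A + b) * w = 2 * l * A * w + 2 * l * b * w" by (simp add: algebra_simps)
  have 4: "d\<^sup>2 / (4 * c) = E / 4" "d\<^sup>2 / (2 * c) = E / 2" "w\<^sup>2 / (8 * \<alpha>) = W / 8" "w\<^sup>2 / \<alpha> = W"
    "rx * \<beta> / 3 * e\<^sup>2 = Q / 3"
    by (simp_all add: E_def W_def Q_def)
  \<comment> \<open>The budget: on the left \<open>W\<close> has total coefficient
    \<open>1/2 + 2/11 + 1/8 + 1/128 < 1\<close>, that of \<open>E\<close> is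
    \<open>1/8 + 1/4 + 1/3072 < 1/2\<close>, and that of \<open>Q\<close> is
    \<open>3/36 + 1/2 + 1/3\<close>, below \<open>1 - 1/72\<close>.\<close>
  have lin: "p + q + v + (3 * bq + sq) + E / 4 + W / 8 + Q / 3 \<le> E / 2 + W + (Q - bq / 2)"
    if "v \<le> W / 11" "q \<le> W / 11" "p \<le> W / 2 + E / 8" "S2 \<le> W / 128 + E / 3072"
      "bq \<le> Q / 36" "sq \<le> Q / 2 + S2" for p q v bq sq S2
    using that W0 E0 Q0 by linarith
  show ?thesis unfolding 1 2 3 4 by (rule lin[OF Lw bterm Aterm Sterm bQ SQ])
qed

context smooth_minimax
begin

context
  fixes rx :: real
  assumes rx: "rx > l"
begin

text \<open>A projected gradient step of size at most the inverse curvature. Besides sufficient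
  decrease it contracts the distance to the inner minimiser, which
  \<open>contraction_error_bound\<close> turns into a bound of that distance by the step
  length.\<close>

lemma gradient_step:
  assumes x: "x \<in> X" and y: "y \<in> Y" and c: "0 < c" "c * (rx + l) \<le> 1"
    and x': "x' = closest_point X (x - c *\<^sub>R gx rx z x y)"
  shows "F rx r z (x', y) + (norm (x' - x))\<^sup>2 / (2 * c) \<le> F rx r z (x, y)"
    and "c * (rx - l) * norm (x' - xarg rx z y) \<le> norm (x' - x)"
proof -
  define g where "g = gx rx z x y"
  define s where "s = xarg rx z y"
  have s: "s \<in> X" unfolding s_def by (rule xarg_in[OF rx y])
  have x'X: "x' \<in> X" using closest_point_in_set[OF X_closed X_ne] x' by simp
  have vi: "(x - c *\<^sub>R g - x') \<bullet> (w - x') \<le> 0" if "w \<in> X" for w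
    using closest_point_dot[OF X_convex X_closed that, of "x - c *\<^sub>R g"] by (simp add: x' g_def)
  have up: "F rx r z (x', y) \<le> F rx r z (x, y) + g \<bullet> (x' - x) + (rx + l) / 2 * (norm (x' - x))\<^sup>2"
    using F_x_upper[OF x x'X y] by (simp add: g_def)
  have M: "c * (rx + l) * (norm (x' - x))\<^sup>2 \<le> (norm (x' - x))\<^sup>2"
    using mult_right_mono[OF c(2), of "(norm (x' - x))\<^sup>2"] by simp
  have "(norm (x' - x))\<^sup>2 + c * (g \<bullet> (x' - x)) \<le> 0"
    using vi[OF x] by (simp add: power2_norm_eq_inner inner_diff_left inner_diff_right algebra_simps inner_commute)
  hence "c * (g \<bullet> (x' - x) + (rx + l) / 2 * (norm (x' - x))\<^sup>2) \<le> - (norm (x' - x))\<^sup>2 / 2"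
    using M unfolding distrib_left[of c "g \<bullet> (x' - x)"] by (simp add: mult.assoc)
  hence "g \<bullet> (x' - x) + (rx + l) / 2 * (norm (x' - x))\<^sup>2 \<le> - (norm (x' - x))\<^sup>2 / (2 * c)"
    using c by (simp add: field_simps)
  thus "F rx r z (x', y) + (norm (x' - x))\<^sup>2 / (2 * c) \<le> F rx r z (x, y)" using up by simp
  have low: "F rx r z (x, y) + g \<bullet> (s - x) + (rx - l) / 2 * (norm (x - s))\<^sup>2 \<le> F rx r z (s, y)"
    using F_x_lower[OF x s y, of rx r z] by (simp add: g_def norm_minus_commute)
  have gr: "F rx r z (s, y) + (rx - l) / 2 * (norm (x' - s))\<^sup>2 \<le> F rx r z (x', y)"
    unfolding s_def by (rule xarg_growth[OF rx y x'X])
  \<comment> \<open>Adding \<open>up\<close>, \<open>low\<close> and \<open>gr\<close> cancels all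
    values of \<open>F\<close>.\<close>
  have "(rx - l) / 2 * ((norm (x' - s))\<^sup>2 + (norm (x - s))\<^sup>2)
      \<le> g \<bullet> (x' - s) + (rx + l) / 2 * (norm (x' - x))\<^sup>2"
    using up low gr by (simp add: inner_diff_right algebra_simps)
  hence "2 * c * ((rx - l) / 2 * ((norm (x' - s))\<^sup>2 + (norm (x - s))\<^sup>2))
      \<le> 2 * c * (g \<bullet> (x' - s) + (rx + l) / 2 * (norm (x' - x))\<^sup>2)"
    using c by (intro mult_left_mono) auto
  hence "c * (rx - l) * ((norm (x' - s))\<^sup>2 + (norm (x - s))\<^sup>2)
      \<le> 2 * (c * (g \<bullet> (x' - s))) + c * (rx + l) * (norm (x' - x))\<^sup>2"
    by (simp add: field_simps)
  moreover have "c * (g \<bullet> (x' - s)) \<le> (x' - s) \<bullet> (x - x')"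
    using vi[OF s] by (simp add: inner_diff_left inner_diff_right algebra_simps inner_commute)
  moreover have "(norm (x - s))\<^sup>2 = (norm (x' - s))\<^sup>2 + 2 * ((x' - s) \<bullet> (x - x')) + (norm (x' - x))\<^sup>2"
    using norm_sq_shift[of x s x'] by (simp add: norm_minus_commute)
  ultimately have "(1 + c * (rx - l)) * (norm (x' - s))\<^sup>2 \<le> (1 - c * (rx - l)) * (norm (x - s))\<^sup>2"
    using M by (simp add: ring_distribs)
  moreover have "norm (x - s) \<le> norm (x' - s) + norm (x' - x)"
    using norm_triangle_ineq4[of "x' - s" "x' - x"] by simp
  ultimately show "c * (rx - l) * norm (x' - xarg rx z y) \<le> norm (x' - x)"
    using contraction_error_bound[of "c * (rx - l)" "norm (x' - s)" "norm (x - s)" "norm (x' - x)"] c rx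
    by (simp add: s_def)
qed

text \<open>Here \<open>n\<close> is a normal vector of \<open>Y\<close> at \<open>y\<close>. Strong
  convexity is used at both inner minimisers and strong concavity between \<open>y\<close> and
  \<open>ys\<close>; the unknown distance \<open>d\<close> disappears since
  \<open>norm v * d - r / 2 * d\<^sup>2\<close> is at most
  \<open>(norm v)\<^sup>2 / (2 * r)\<close>.\<close>

lemma dual_error_bound:
  assumes r: "0 < r" and ys: "ys \<in> Y"
    and saddle: "\<forall>y\<in>Y. F rx r z (xarg rx z ys, y) \<le> F rx r z (xarg rx z ys, ys)"
    and y: "y \<in> Y" and n: "\<And>y'. y' \<in> Y \<Longrightarrow> n \<bullet> (y' - y) \<le> 0"
  shows "2 * r * (rx - l) * (norm (xarg rx z y - xarg rx z ys))\<^sup>2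
    \<le> (norm (gy r (xarg rx z y) y - n))\<^sup>2"
proof -
  define a s where "a = xarg rx z y" and "s = xarg rx z ys"
  have a: "a \<in> X" and s: "s \<in> X" using xarg_in[OF rx] y ys by (auto simp: a_def s_def)
  define v where "v = gy r a y - n"
  define d where "d = norm (ys - y)"
  have 1: "F rx r z (a, y) + (rx - l) / 2 * (norm (a - s))\<^sup>2 \<le> F rx r z (s, y)"
    using xarg_growth[OF rx y s] by (simp add: a_def norm_minus_commute)
  have 2: "F rx r z (s, ys) + (rx - l) / 2 * (norm (a - s))\<^sup>2 \<le> F rx r z (a, ys)"
    using xarg_growth[OF rx ys a] by (simp add: s_def)
  have 3: "F rx r z (a, ys) \<le> F rx r z (a, y) + gy r a y \<bullet> (ys - y) - r / 2 * d\<^sup>2"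
    unfolding d_def by (rule F_y_upper[OF a y ys])
  have 4: "F rx r z (s, y) \<le> F rx r z (s, ys)" unfolding s_def using saddle y by blast
  have 5: "gy r a y \<bullet> (ys - y) \<le> norm v * d"
    using n[OF ys] norm_cauchy_schwarz[of v "ys - y"] by (simp add: v_def d_def inner_diff_left)
  have "(rx - l) * (norm (a - s))\<^sup>2 \<le> norm v * d - r / 2 * d\<^sup>2" using 1 2 3 4 5 by (simp add: field_simps)
  hence "2 * r * ((rx - l) * (norm (a - s))\<^sup>2) \<le> 2 * r * (norm v * d - r / 2 * d\<^sup>2)"
    using r by (intro mult_left_mono) auto
  also have "\<dots> = (norm v)\<^sup>2 - (norm v - r * d)\<^sup>2" by (simp add: power2_eq_square algebra_simps)
  finally show ?thesis unfolding v_def[symmetric] a_def[symmetric] s_def[symmetric]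
    using zero_le_power2[of "norm v - r * d"] unfolding mult.assoc by linarith
qed

section \<open>The Lyapunov function through values of \<open>F\<close>, and its lower bound\<close>

lemma INF_F: "y \<in> Y \<Longrightarrow> (INF x\<in>X. F rx r z (x, y)) = F rx r z (xarg rx z y, y)"
  by (rule cInf_eq_minimum) (auto intro: xarg_min[OF rx] xarg_in[OF rx])

text \<open>At the \<open>x\<close>-part of the saddle pair the supremum is attained at
  \<open>ys\<close>; at any other \<open>x\<close> the value at \<open>ys\<close> is already at
  least the saddle value. Compactness of \<open>Y\<close> keeps the suprema finite.\<close>

lemma INF_SUP_F:
  assumes ys: "ys \<in> Y"
    and saddle: "\<forall>y\<in>Y. F rx r z (xarg rx z ys, y) \<le> F rx r z (xarg rx z ys, ys)"
  shows "(INF x\<in>X. SUP y\<in>Y. F rx r z (x, y)) = F rx r z (xarg rx z ys, ys)"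
proof (rule cInf_eq_minimum)
  have "(SUP y\<in>Y. F rx r z (xarg rx z ys, y)) = F rx r z (xarg rx z ys, ys)"
    by (rule cSup_eq_maximum) (use ys saddle in auto)
  thus "F rx r z (xarg rx z ys, ys) \<in> (\<lambda>x. SUP y\<in>Y. F rx r z (x, y)) ` X"
    by (intro image_eqI[of _ _ "xarg rx z ys"]) (simp_all add: xarg_in[OF rx ys])
next
  fix v assume "v \<in> (\<lambda>x. SUP y\<in>Y. F rx r z (x, y)) ` X"
  then obtain x where x: "x \<in> X" "v = (SUP y\<in>Y. F rx r z (x, y))" by blast
  have "compact ((\<lambda>y. F rx r z (x, y)) ` Y)"
    by (intro compact_continuous_image Y_compact continuous_on_compose2[OF F_continuous[of UNIV]])
      (auto intro!: continuous_intros)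
  hence "bdd_above ((\<lambda>y. F rx r z (x, y)) ` Y)" by (simp add: bounded_imp_bdd_above compact_imp_bounded)
  hence "F rx r z (x, ys) \<le> v" unfolding x using ys by (rule cSUP_upper2) simp
  thus "F rx r z (xarg rx z ys, ys) \<le> v" using xarg_min[OF rx ys x(1), of r z] by linarith
qed

lemma Psi2_eq:
  assumes y: "y \<in> Y" and ys: "ys \<in> Y"
    and saddle: "\<forall>y\<in>Y. F rx r z (xarg rx z ys, y) \<le> F rx r z (xarg rx z ys, ys)"
  shows "Psi2 f X Y rx r x y z
    = F rx r z (x, y) - 2 * F rx r z (xarg rx z y, y) + 2 * F rx r z (xarg rx z ys, ys)"
  unfolding Psi2_def INF_F[OF y] INF_SUP_F[OF ys saddle] by simp

text \<open>With dual value \<open>d\<close> and minimax value \<open>P\<close>, the function is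
  \<open>(F - d) + (P - d) + P\<close> and both brackets are nonnegative. Moreover \<open>P\<close>
  is the maximum over \<open>y\<close> at the point \<open>s\<close>, and dropping the proximal term
  there leaves the primal value.\<close>

lemma Psi2_lower_bound:
  assumes r: "r \<ge> 0" and bdd: "gap_finite f X Y r" and x: "x \<in> X" and y: "y \<in> Y"
  shows "(INF x\<in>X. primal_reg f Y r x) \<le> Psi2 f X Y rx r x y z"
proof -
  obtain ys where ys: "ys \<in> Y"
    and saddle: "\<forall>y\<in>Y. F rx r z (xarg rx z ys, y) \<le> F rx r z (xarg rx z ys, ys)"
    using ex_saddle[OF rx r] by blast
  define s where "s = xarg rx z ys"
  have s: "s \<in> X" unfolding s_def by (rule xarg_in[OF rx ys])
  have "(INF x\<in>X. primal_reg f Y r x) \<le> primal_reg f Y r s"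
    using bdd s by (intro cINF_lower) (auto simp: gap_finite_def)
  also have "\<dots> \<le> F rx r z (s, ys)" unfolding primal_reg_def
  proof (rule cSUP_least[OF Y_ne])
    fix y' assume "y' \<in> Y"
    have "f (s, y') - r / 2 * (norm y')\<^sup>2 \<le> F rx r z (s, y')" using rx l_pos by (simp add: F_eq)
    also have "\<dots> \<le> F rx r z (s, ys)" using saddle \<open>y' \<in> Y\<close> by (simp add: s_def)
    finally show "f (s, y') - r / 2 * (norm y')\<^sup>2 \<le> F rx r z (s, ys)" .
  qed
  also have "\<dots> \<le> Psi2 f X Y rx r x y z"
    unfolding Psi2_eq[OF y ys saddle]
    using xarg_min[OF rx y x, of r z] xarg_min[OF rx y s, of r z] bspec[OF saddle y] by (simp add: s_def)
  finally show ?thesis .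
qed

end

text \<open>The dependence on \<open>z\<close> is quadratic, so the expansion is exact. The point
  \<open>x\<close> enters the increment only linearly, so the difference of two increments is an
  inner product with \<open>e\<close>.\<close>

lemma F_shift_z:
  "F rx r (z + \<beta> *\<^sub>R e) (x, y)
    = F rx r z (x, y) + rx / 2 * (\<beta>\<^sup>2 * (norm e)\<^sup>2 - 2 * \<beta> * ((x - z) \<bullet> e))"
proof -
  have "(norm (x - (z + \<beta> *\<^sub>R e)))\<^sup>2 = (norm (x - z))\<^sup>2 - 2 * \<beta> * ((x - z) \<bullet> e) + \<beta>\<^sup>2 * (norm e)\<^sup>2"
    unfolding diff_diff_eq[symmetric] power2_norm_eq_inner
    by (simp add: inner_diff_left[of "x - z"] inner_diff_right[of _ "x - z"] inner_commute power2_eq_square)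
  thus ?thesis unfolding F_eq by (simp only:) (simp add: algebra_simps)
qed

text \<open>The \<open>y\<close>-step raises \<open>F\<close> by at most \<open>g1\<close> and the
  dual value by at least \<open>g1\<close> minus curvature errors; as the dual value counts twice, a
  net gain of about \<open>g1\<close> remains. The errors of all three steps are balanced in
  \<open>descent_arithmetic\<close>.\<close>

lemma descent_step:
  assumes r: "0 < r" and rx: "3 * l < rx"
    and c: "0 < c" "c * (rx + l) \<le> 1"
    and \<alpha>: "0 < \<alpha>" "11 * \<alpha> * (l + r) \<le> 1" "4 * \<alpha> * (l + r) \<le> (c * (rx - l))\<^sup>2"
    and \<beta>: "0 < \<beta>" "\<beta> \<le> 1 / 36" "384 * rx * \<beta> \<le> r * (rx - l) * \<alpha>"
    and x: "x \<in> X" and y: "y \<in> Y"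
    and x': "x' = closest_point X (x - c *\<^sub>R gx rx z x y)"
    and y': "y' = closest_point Y (y + \<alpha> *\<^sub>R gy r x' y)"
    and z': "z' = z + \<beta> *\<^sub>R (x' - z)"
  shows "Psi2 f X Y rx r x' y' z' + (norm (x' - x))\<^sup>2 / (4 * c) + (norm (y' - y))\<^sup>2 / (8 * \<alpha>)
      + rx * \<beta> / 3 * (norm (x' - z))\<^sup>2 \<le> Psi2 f X Y rx r x y z"
proof -
  have rxl: "rx > l" using rx l_pos by simp
  have x'X: "x' \<in> X" using closest_point_in_set[OF X_closed X_ne] x' by simp
  have y'Y: "y' \<in> Y" using closest_point_in_set[OF Y_closed Y_ne] y' by simp
  obtain ys where ys: "ys \<in> Y"
    and sad: "\<forall>y\<in>Y. F rx r z (xarg rx z ys, y) \<le> F rx r z (xarg rx z ys, ys)"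
    using ex_saddle[OF rxl] r by (metis less_imp_le)
  obtain ys' where ys': "ys' \<in> Y"
    and sad': "\<forall>y\<in>Y. F rx r z' (xarg rx z' ys', y) \<le> F rx r z' (xarg rx z' ys', ys')"
    using ex_saddle[OF rxl] r by (metis less_imp_le)
  \<comment> \<open>\<open>s\<close> belongs to the saddle point for the old \<open>z\<close>;
    \<open>a0\<close>, \<open>a\<close>, \<open>q\<close> are the inner minimisers for old
    \<open>y\<close> and old \<open>z\<close>, new \<open>y\<close> and old \<open>z\<close>, new
    \<open>y\<close> and new \<open>z\<close>.\<close>
  define s a a0 q e where "s = xarg rx z ys" and "a = xarg rx z y'" and "a0 = xarg rx z y"
    and "q = xarg rx z' y'" and "e = x' - z"
  have sX: "s \<in> X" and aX: "a \<in> X" and a0X: "a0 \<in> X" and qX: "q \<in> X"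
    using xarg_in[OF rxl] ys y y'Y by (auto simp: s_def a_def a0_def q_def)
  \<comment> \<open>What the projection removes, divided by \<open>\<alpha>\<close>: a normal vector
    of \<open>Y\<close> at \<open>y'\<close>, as \<open>dual_error_bound\<close> asks for.\<close>
  define n where "n = gy r x' y - (1 / \<alpha>) *\<^sub>R (y' - y)"
  have n: "n \<bullet> (w - y') \<le> 0" if "w \<in> Y" for w
  proof -
    have "(y + \<alpha> *\<^sub>R gy r x' y - y') \<bullet> (w - y') \<le> 0"
      using closest_point_dot[OF Y_convex Y_closed that, of "y + \<alpha> *\<^sub>R gy r x' y"] by (simp add: y')
    moreover have "y + \<alpha> *\<^sub>R gy r x' y - y' = \<alpha> *\<^sub>R n" using \<alpha> by (simp add: n_def algebra_simps)
    ultimately have "\<alpha> * (n \<bullet> (w - y')) \<le> 0" by simp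
    thus ?thesis using \<alpha> by (simp add: mult_le_0_iff)
  qed
  define g1 where "g1 = gy r x' y \<bullet> (y' - y)"
  have g1: "(norm (y' - y))\<^sup>2 / \<alpha> \<le> g1"
  proof -
    have e: "y - y' = - (y' - y)" by simp
    have "n \<bullet> (y - y') = (1 / \<alpha>) * ((y' - y) \<bullet> (y' - y)) - g1"
      unfolding n_def g1_def e inner_minus_right
      by (simp only: inner_diff_left[of "gy r x' y"] inner_scaleR_left minus_diff_eq)
    thus ?thesis using n[OF y] by (simp add: power2_norm_eq_inner)
  qed
  define A b where "A = norm (x' - a0)" and "b = norm (a - a0)"
  have ax': "norm (a - x') \<le> A + b"
    using norm_triangle_ineq4[of "a - a0" "x' - a0"] by (simp add: A_def b_def)
  have gyl: "norm (gy r u w - gy r u' w') \<le> l * norm (u - u') + (l + r) * norm (w - w')"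
    if "u \<in> X" "u' \<in> X" "w \<in> Y" "w' \<in> Y" for u u' w w'
  proof -
    have "gy r u w - gy r u' w' = (grad_y f u w - grad_y f u' w') - r *\<^sub>R (w - w')"
      by (simp add: gy_def algebra_simps)
    hence "norm (gy r u w - gy r u' w')
        \<le> norm (grad_y f u w - grad_y f u' w') + norm (r *\<^sub>R (w - w'))"
      using norm_triangle_ineq4 by metis
    moreover have "norm (r *\<^sub>R (w - w')) = r * norm (w - w')" using r by simp
    ultimately show ?thesis using gy_lip[OF that] r by (simp add: ring_distribs)
  qed
  \<comment> \<open>The algorithm uses the gradient at \<open>x'\<close>, the dual value is
    evaluated at \<open>a\<close>; exchanging the two points costs \<open>l * (A + b)\<close> per
    unit of step length.\<close>
  have d_step: "F rx r z (a0, y) + g1 - l * (A + b) * norm (y' - y) - (l + r) / 2 * (norm (y' - y))\<^sup>2 \<le> F rx r z (a, y')"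
  proof -
    have "(gy r x' y - gy r a y) \<bullet> (y' - y) \<le> norm (gy r x' y - gy r a y) * norm (y' - y)"
      by (rule norm_cauchy_schwarz)
    also have "\<dots> \<le> l * (A + b) * norm (y' - y)"
    proof (rule mult_right_mono)
      have "norm (gy r x' y - gy r a y) \<le> l * norm (x' - a)" using gyl[OF x'X aX y y] by simp
      also have "\<dots> \<le> l * (A + b)" using ax' l_pos by (simp add: norm_minus_commute)
      finally show "norm (gy r x' y - gy r a y) \<le> l * (A + b)" .
    qed simp
    finally have "g1 - l * (A + b) * norm (y' - y) \<le> gy r a y \<bullet> (y' - y)"
      by (simp add: g1_def inner_diff_left)
    moreover have "F rx r z (a0, y) \<le> F rx r z (a, y)" unfolding a0_def by (rule xarg_min[OF rxl y aX])
    ultimately show ?thesis using F_y_lower[OF aX y y'Y, of rx r z] by linarith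
  qed
  have x_step: "F rx r z (x', y) + (norm (x' - x))\<^sup>2 / (2 * c) \<le> F rx r z (x, y)"
    and A_le: "c * (rx - l) * A \<le> norm (x' - x)"
    using gradient_step[OF rxl x y c x'] by (auto simp: A_def a0_def)
  have y_step: "F rx r z (x', y') \<le> F rx r z (x', y) + g1"
    using F_y_upper[OF x'X y y'Y, of rx r z] r unfolding g1_def
    by (smt (verit) mult_nonneg_nonneg zero_le_power2 divide_nonneg_nonneg)
  have b_le: "(rx - l) * b \<le> l * norm (y' - y)"
    using xarg_lipschitz[OF rxl y'Y y, of z z] by (simp add: b_def a_def a0_def)
  have V: "norm (gy r a y' - n) \<le> norm (y' - y) / \<alpha> + (l + r) * norm (y' - y) + l * (A + b)"
  proof -
    have "gy r a y' - n = (gy r a y' - gy r x' y) + (1 / \<alpha>) *\<^sub>R (y' - y)" by (simp add: n_def)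
    hence "norm (gy r a y' - n) \<le> norm (gy r a y' - gy r x' y) + norm ((1 / \<alpha>) *\<^sub>R (y' - y))"
      by (metis norm_triangle_ineq)
    moreover have "norm ((1 / \<alpha>) *\<^sub>R (y' - y)) = norm (y' - y) / \<alpha>" using \<alpha> by simp
    ultimately show ?thesis using gyl[OF aX x'X y'Y y] mult_left_mono[OF ax', of l] l_pos by linarith
  qed
  have S: "2 * r * (rx - l) * (norm (a - s))\<^sup>2 \<le> (norm (gy r a y' - n))\<^sup>2"
    unfolding a_def s_def by (rule dual_error_bound[OF rxl r ys sad y'Y n])
  have z'e: "z' = z + \<beta> *\<^sub>R e" by (simp add: z' e_def)
  \<comment> \<open>Through the intermediate point \<open>a\<close>. The factor \<open>3 / 2\<close>
    bounds \<open>rx / (rx - l)\<close>, as \<open>3 * l < rx\<close>.\<close>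
  have qs: "norm (q - s) \<le> 3 / 2 * \<beta> * norm e + norm (a - s)"
  proof -
    have "(rx - l) * norm (q - a) \<le> rx * (\<beta> * norm e)"
      using xarg_lipschitz[OF rxl y'Y y'Y, of z' z] \<beta> by (simp add: q_def a_def z'e)
    also have "\<dots> \<le> (3 / 2 * (rx - l)) * (\<beta> * norm e)" using rx \<beta> by (intro mult_right_mono) auto
    finally have "(rx - l) * norm (q - a) \<le> (rx - l) * (3 / 2 * \<beta> * norm e)" by (simp only: mult_ac)
    hence "norm (q - a) \<le> 3 / 2 * \<beta> * norm e" using rxl by (simp only: mult_le_cancel_left_pos diff_gt_0_iff_gt)
    moreover have "norm (q - s) \<le> norm (q - a) + norm (a - s)"
      using norm_triangle_ineq[of "q - a" "a - s"] by simp
    ultimately show ?thesis by linarith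
  qed
  have z_F: "F rx r z' (x', y') = F rx r z (x', y') - rx / 2 * (2 * \<beta> - \<beta>\<^sup>2) * (norm e)\<^sup>2"
    unfolding z'e F_shift_z by (simp add: e_def[symmetric] power2_norm_eq_inner algebra_simps)
  have z_d: "F rx r z (a, y') + rx / 2 * (\<beta>\<^sup>2 * (norm e)\<^sup>2 - 2 * \<beta> * ((q - z) \<bullet> e)) \<le> F rx r z' (q, y')"
    using xarg_min[OF rxl y'Y qX, of r z] unfolding z'e F_shift_z by (simp add: a_def)
  \<comment> \<open>For the new \<open>z\<close> the old \<open>s\<close> is only a trial point, and
    the old saddle property bounds its value at whatever \<open>ys'\<close> is.\<close>
  have z_P: "F rx r z' (xarg rx z' ys', ys')
      \<le> F rx r z (s, ys) + rx / 2 * (\<beta>\<^sup>2 * (norm e)\<^sup>2 - 2 * \<beta> * ((s - z) \<bullet> e))"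
  proof -
    have "F rx r z' (xarg rx z' ys', ys') \<le> F rx r z' (s, ys')" by (rule xarg_min[OF rxl ys' sX])
    also have "\<dots> \<le> F rx r z (s, ys) + rx / 2 * (\<beta>\<^sup>2 * (norm e)\<^sup>2 - 2 * \<beta> * ((s - z) \<bullet> e))"
      using bspec[OF sad ys'] unfolding z'e F_shift_z by (simp add: s_def)
    finally show ?thesis .
  qed
  have qse: "2 * rx * \<beta> * ((q - s) \<bullet> e) \<le> 2 * rx * \<beta> * (3 / 2 * \<beta> * norm e + norm (a - s)) * norm e"
  proof -
    have "(q - s) \<bullet> e \<le> norm (q - s) * norm e" by (rule norm_cauchy_schwarz)
    also have "\<dots> \<le> (3 / 2 * \<beta> * norm e + norm (a - s)) * norm e" using qs by (intro mult_right_mono) auto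
    finally have "(2 * rx * \<beta>) * ((q - s) \<bullet> e)
        \<le> (2 * rx * \<beta>) * ((3 / 2 * \<beta> * norm e + norm (a - s)) * norm e)"
      using rxl l_pos \<beta> by (intro mult_left_mono) auto
    thus ?thesis by (simp only: mult.assoc)
  qed
  \<comment> \<open>The terms in \<open>\<beta>\<^sup>2\<close> and the parts of the inner products
    with \<open>z\<close> cancel between \<open>z_d\<close> and \<open>z_P\<close>.\<close>
  have zdP: "2 * F rx r z' (xarg rx z' ys', ys') - 2 * F rx r z' (q, y')
     \<le> 2 * F rx r z (s, ys) - 2 * F rx r z (a, y') + 2 * rx * \<beta> * ((q - s) \<bullet> e)"
    using z_d z_P by (simp add: algebra_simps inner_diff_left)
  have "Psi2 f X Y rx r x y z = F rx r z (x, y) - 2 * F rx r z (a0, y) + 2 * F rx r z (s, ys)"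
    unfolding Psi2_eq[OF rxl y ys sad] by (simp add: a0_def s_def)
  moreover have "Psi2 f X Y rx r x' y' z'
      = F rx r z' (x', y') - 2 * F rx r z' (q, y') + 2 * F rx r z' (xarg rx z' ys', ys')"
    unfolding Psi2_eq[OF rxl y'Y ys' sad'] by (simp add: q_def)
  moreover note descent_arithmetic[OF l_pos r refl refl rx c \<alpha> \<beta> _ _ _ _ _ _ _ A_le b_le S V, of "norm e"]
  ultimately show ?thesis
    using x_step y_step d_step g1 z_F zdP qse
    unfolding e_def[symmetric] by (simp add: A_def b_def)
qed

end

section \<open>Stationarity of the iterates\<close>

lemma subdifferential_convex_indicatorI:
  assumes "x \<in> S" "\<And>w. w \<in> S \<Longrightarrow> v \<bullet> (w - x) \<le> 0"
  shows "v \<in> subdifferential (convex_indicator S) x"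
  using assms by (auto simp: subdifferential_def convex_indicator_def zero_ereal_def)

text \<open>Dropping the nonnegative second summand of the numerator leaves
  \<open>1 / (sqrt r * \<alpha> * sqrt p)\<close> with \<open>p = rx - l - r\<close> as a lower
  bound of \<open>omega\<close>. This turns the condition on \<open>\<beta>\<close> into one
  proportional to \<open>r\<close>.\<close>

lemma omega_lower_bound:
  assumes "0 < l" "0 < r" "0 < \<alpha>" "r + l < rx" "2 * (l + r) < 3 * rx"
  shows "1 \<le> (omega l rx r \<alpha>)\<^sup>2 * (r * \<alpha>\<^sup>2 * (rx - l - r))"
proof -
  define p where "p = rx - l - r"
  have p: "p > 0" using assms by (simp add: p_def)
  define N where "N = p + \<alpha> * (l + r) * (3 * rx - 2 * l - 2 * r)"
  have N: "N \<ge> p" using assms unfolding N_def by (intro le_add_same_cancel1[THEN iffD2] mult_nonneg_nonneg) auto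
  have p3: "(p powr (3 / 2))\<^sup>2 = p ^ 3"
    using p by (simp add: powr_power powr_numeral)
  have "(omega l rx r \<alpha>)\<^sup>2 = N\<^sup>2 / (r * \<alpha>\<^sup>2 * p ^ 3)"
    unfolding omega_def p_def[symmetric] N_def[symmetric] power_mult_distrib power_divide p3
    using assms by simp
  hence "(omega l rx r \<alpha>)\<^sup>2 * (r * \<alpha>\<^sup>2 * p) = N\<^sup>2 / p\<^sup>2"
    using p assms by (simp add: field_simps power2_eq_square power3_eq_cube)
  moreover have "p\<^sup>2 \<le> N\<^sup>2" using N p by (intro power_mono) auto
  ultimately show ?thesis using p by (simp add: p_def)
qed

text \<open>The step sizes of the paper are smaller than what the descent estimate needs.\<close>

lemma step_size_consequences:
  assumes ss: "step_size_conditions k K l rx ry c \<alpha> \<beta>" and l: "0 < l" and r: "ry t = r" "r < 2 * l"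
  shows "0 < r" "3 * l < rx" "0 < c t" "c t * (rx + l) \<le> 1"
    "0 < \<alpha> t" "11 * \<alpha> t * (l + r) \<le> 1" "4 * \<alpha> t * (l + r) \<le> (c t * (rx - l))\<^sup>2"
    "0 < \<beta> t" "\<beta> t \<le> 1 / 36" "384 * rx * \<beta> t \<le> r * (rx - l) * \<alpha> t"
    "k / l \<le> \<alpha> t" "k / l \<le> c t" "k * r / l \<le> \<beta> t" "rx \<le> K * l"
proof -
  have ss': "theta_with k K rx l" "rx > 3 * l" "ry t > 0"
    "theta_with k K (\<alpha> t) (1 / l)" "0 < \<alpha> t" "\<alpha> t \<le> 1 / (11 * (l + r))"
    "\<alpha> t \<le> (c t)\<^sup>2 * (rx - l - r)\<^sup>2 / (4 * (l + r) * (1 + c t * (rx - l - r))\<^sup>2)"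
    "theta_with k K (c t) (1 / l)" "0 < c t" "c t < 1 / (rx + l + r)"
    "0 < \<beta> t" "\<beta> t \<le> 1 / 36" "theta_with k K (\<beta> t) (r / l)"
    "\<beta> t \<le> 1 / (384 * rx * \<alpha> t * (omega l rx r (\<alpha> t))\<^sup>2)"
    using ss unfolding step_size_conditions_def r(1)[symmetric] by (auto simp only: min.bounded_iff)
  show "0 < r" "3 * l < rx" "0 < c t" "0 < \<alpha> t" "0 < \<beta> t" "\<beta> t \<le> 1 / 36"
    using ss' r by simp_all
  show "k / l \<le> \<alpha> t" "k / l \<le> c t" "k * r / l \<le> \<beta> t" "rx \<le> K * l"
    using ss' by (auto simp: theta_with_def)
  define p where "p = rx - l - r"
  \<comment> \<open>Positivity of \<open>p\<close> comes from \<open>r < 2 * l\<close> together with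
    \<open>3 * l < rx\<close>.\<close>
  have rpos: "0 < r" and p: "0 < p" using ss' r by (auto simp: p_def)
  have "c t * (rx + l + r) \<le> 1" using ss'(2,10) l rpos by (simp add: field_simps)
  moreover have "c t * r \<ge> 0" using ss' rpos by simp
  ultimately show "c t * (rx + l) \<le> 1" by (simp add: algebra_simps)
  show "11 * \<alpha> t * (l + r) \<le> 1" using ss'(6) l rpos by (simp add: field_simps)
  have "\<alpha> t \<le> (c t * p)\<^sup>2 / (4 * (l + r) * (1 + c t * p)\<^sup>2)"
    using ss'(7) by (simp add: p_def power_mult_distrib)
  also have "\<dots> \<le> (c t * p)\<^sup>2 / (4 * (l + r) * 1)"
    using l rpos p ss'(9) by (intro frac_le mult_left_mono) auto
  finally have "4 * \<alpha> t * (l + r) \<le> (c t * p)\<^sup>2" using l rpos by (simp add: field_simps)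
  also have "\<dots> \<le> (c t * (rx - l))\<^sup>2" using p ss'(9) rpos by (intro power_mono mult_left_mono) (auto simp: p_def)
  finally show "4 * \<alpha> t * (l + r) \<le> (c t * (rx - l))\<^sup>2" .
  define W where "W = (omega l rx r (\<alpha> t))\<^sup>2"
  have W: "1 \<le> W * (r * (\<alpha> t)\<^sup>2 * p)"
    unfolding W_def p_def using ss' rpos l r by (intro omega_lower_bound) auto
  have Wpos: "0 < W"
  proof (rule ccontr)
    assume "\<not> 0 < W"
    hence "W * (r * (\<alpha> t)\<^sup>2 * p) \<le> 0" using rpos p by (intro mult_nonpos_nonneg) auto
    thus False using W by linarith
  qed
  have "384 * rx * \<alpha> t * W * \<beta> t \<le> 1"
    using ss'(14) ss'(2,5) l Wpos unfolding W_def[symmetric] by (simp add: field_simps)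
  also have "\<dots> \<le> W * (r * (\<alpha> t)\<^sup>2 * p)" by (rule W)
  finally have "(W * \<alpha> t) * (384 * rx * \<beta> t) \<le> (W * \<alpha> t) * (r * p * \<alpha> t)"
    by (simp add: power2_eq_square mult_ac)
  hence "384 * rx * \<beta> t \<le> r * p * \<alpha> t" using Wpos ss'(5) by simp
  also have "\<dots> \<le> r * (rx - l) * \<alpha> t" using rpos ss'(5) by (intro mult_right_mono mult_left_mono) (auto simp: p_def)
  finally show "384 * rx * \<beta> t \<le> r * (rx - l) * \<alpha> t" .
qed

text \<open>Two tolerances are kept apart: \<open>\<eta>\<close> for the \<open>x\<close>- and
  \<open>y\<close>-steps, whose step sizes are at least \<open>k / l\<close>, and
  \<open>\<zeta>\<close> for the \<open>z\<close>-step, where only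
  \<open>\<beta> \<ge> k * r / l\<close> holds and a factor \<open>1 / r\<close> is lost.
  Optimization stationarity relies on the \<open>y\<close>-residual being free of
  \<open>\<zeta>\<close>.\<close>

lemma residual_arithmetic:
  fixes K c d e k l r rx w \<alpha> \<beta> \<delta> \<eta> \<zeta> :: real
  assumes l: "0 < l" and k: "0 < k" and r: "0 < r" and rx: "0 < rx" "rx \<le> K * l"
    and c: "k / l \<le> c" and \<alpha>: "k / l \<le> \<alpha>" "l * \<alpha> \<le> 1 / 11" and \<beta>: "k * r / l \<le> \<beta>"
    and nonneg: "0 \<le> d" "0 \<le> w" "0 \<le> e" "0 \<le> \<delta>" "0 \<le> \<eta>" "0 \<le> \<zeta>"
    and small: "d\<^sup>2 / (4 * c) + w\<^sup>2 / (8 * \<alpha>) + rx * \<beta> / 3 * e\<^sup>2 \<le> \<delta>"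
    and \<eta>: "\<delta> * l / k \<le> \<eta>\<^sup>2" and \<zeta>: "3 * K * l\<^sup>2 * \<delta> / (k * r) \<le> \<zeta>\<^sup>2"
  shows "2 * d / c + l * w + rx * e \<le> 5 * \<eta> + \<zeta>" and "2 * w / \<alpha> \<le> 6 * \<eta>"
proof -
  have kl: "0 < k / l" using k l by simp
  have c0: "0 < c" and \<alpha>0: "0 < \<alpha>" using kl c \<alpha> by linarith+
  have "0 < k * r / l" using k l r by simp
  hence \<beta>0: "0 < \<beta>" using \<beta> by linarith
  have inv: "\<delta> / u \<le> \<eta>\<^sup>2" if "k / l \<le> u" for u
  proof -
    have "\<delta> / u \<le> \<delta> / (k / l)" using nonneg kl that by (intro frac_le) auto
    thus ?thesis using \<eta> by simp
  qed
  have pos: "0 \<le> d\<^sup>2 / (4 * c)" "0 \<le> w\<^sup>2 / (8 * \<alpha>)" "0 \<le> rx * \<beta> / 3 * e\<^sup>2"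
    using c0 \<alpha>0 \<beta>0 rx by auto
  have "(d / c)\<^sup>2 \<le> (2 * \<eta>)\<^sup>2"
  proof -
    have "d\<^sup>2 / (4 * c) \<le> \<delta>" using small pos by linarith
    hence "(d / c)\<^sup>2 \<le> 4 * (\<delta> / c)" using c0 by (simp add: field_simps power2_eq_square)
    thus ?thesis using inv[OF c] by (simp add: power_mult_distrib)
  qed
  hence d: "d / c \<le> 2 * \<eta>" by (rule power2_le_imp_le) (use nonneg in auto)
  have "(w / \<alpha>)\<^sup>2 \<le> (3 * \<eta>)\<^sup>2"
  proof -
    have "w\<^sup>2 / (8 * \<alpha>) \<le> \<delta>" using small pos by linarith
    hence "(w / \<alpha>)\<^sup>2 \<le> 8 * (\<delta> / \<alpha>)" using \<alpha>0 by (simp add: field_simps power2_eq_square)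
    also have "\<dots> \<le> 9 * \<eta>\<^sup>2" using inv[OF \<alpha>(1)] zero_le_power2[of \<eta>] by linarith
    finally show ?thesis by (simp add: power_mult_distrib)
  qed
  hence w: "w / \<alpha> \<le> 3 * \<eta>" by (rule power2_le_imp_le) (use nonneg in auto)
  thus "2 * w / \<alpha> \<le> 6 * \<eta>" by simp
  have "l * w = (l * \<alpha>) * (w / \<alpha>)" using \<alpha>0 by simp
  also have "\<dots> \<le> 1 / 11 * (3 * \<eta>)" using \<alpha> w nonneg \<alpha>0 by (intro mult_mono) auto
  finally have lw: "l * w \<le> \<eta>" using nonneg by simp
  have "(rx * e)\<^sup>2 \<le> \<zeta>\<^sup>2"
  proof -
    have "rx * \<beta> / 3 * e\<^sup>2 \<le> \<delta>" using small pos by linarith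
    hence le: "rx * \<beta> * e\<^sup>2 \<le> 3 * \<delta>" by simp
    have Kl: "0 \<le> K * l" using rx by linarith
    have "rx * (rx * \<beta> * e\<^sup>2) \<le> K * l * (3 * \<delta>)"
      by (rule mult_mono[OF rx(2) le Kl]) (use rx \<beta>0 in simp)
    hence "\<beta> * (rx * e)\<^sup>2 \<le> 3 * K * l * \<delta>" by (simp add: power2_eq_square mult_ac)
    moreover have "k * r / l * (rx * e)\<^sup>2 \<le> \<beta> * (rx * e)\<^sup>2" using \<beta> by (intro mult_right_mono) auto
    ultimately have "k * r / l * (rx * e)\<^sup>2 \<le> 3 * K * l * \<delta>" by linarith
    hence "(rx * e)\<^sup>2 \<le> 3 * K * l\<^sup>2 * \<delta> / (k * r)"
      using k r l by (simp add: field_simps power2_eq_square)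
    thus ?thesis using \<zeta> by linarith
  qed
  hence "rx * e \<le> \<zeta>" by (rule power2_le_imp_le) (use nonneg in auto)
  thus "2 * d / c + l * w + rx * e \<le> 5 * \<eta> + \<zeta>" using d lw by linarith
qed

context smooth_minimax
begin

section \<open>From step lengths to first-order residuals\<close>

lemma norm_Y_le: "y \<in> Y \<Longrightarrow> norm y \<le> diameter Y"
  using diameter_bounded_bound[OF compact_imp_bounded[OF Y_compact] _ zero_Y, of y] by simp

text \<open>The normal vector is what the projection removes. Moving the gradient to the new point
  and splitting \<open>x - z\<close> at \<open>x'\<close> leaves two multiples of
  \<open>x' - x\<close>, each with factor at most \<open>1 / c\<close>, which explains the
  2.\<close>

lemma x_residual:
  assumes x: "x \<in> X" and y: "y \<in> Y" and y': "y' \<in> Y" and rx: "0 < rx" and c: "0 < c" "c * (rx + l) \<le> 1"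
    and x': "x' = closest_point X (x - c *\<^sub>R gx rx z x y)"
  obtains n where "\<And>w. w \<in> X \<Longrightarrow> n \<bullet> (w - x') \<le> 0"
    and "norm (grad_x f x' y' + n) \<le> 2 * norm (x' - x) / c + l * norm (y' - y) + rx * norm (x' - z)"
proof
  define n where "n = (1 / c) *\<^sub>R (x - x') - gx rx z x y"
  have x'X: "x' \<in> X" using closest_point_in_set[OF X_closed X_ne] x' by simp
  show "n \<bullet> (w - x') \<le> 0" if "w \<in> X" for w
  proof -
    have "(x - c *\<^sub>R gx rx z x y - x') \<bullet> (w - x') \<le> 0"
      using closest_point_dot[OF X_convex X_closed that] by (simp add: x')
    moreover have "x - c *\<^sub>R gx rx z x y - x' = c *\<^sub>R n" using c by (simp add: n_def algebra_simps)
    ultimately show ?thesis using c by (simp add: mult_le_0_iff)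
  qed
  have "grad_x f x' y' + n
      = (grad_x f x' y' - grad_x f x y) + (1 / c - rx) *\<^sub>R (x - x') - rx *\<^sub>R (x' - z)"
    by (simp add: n_def gx_def algebra_simps)
  hence "norm (grad_x f x' y' + n)
      \<le> norm (grad_x f x' y' - grad_x f x y) + norm ((1 / c - rx) *\<^sub>R (x - x')) + norm (rx *\<^sub>R (x' - z))"
    by (metis norm_triangle_ineq norm_triangle_ineq4 add_right_mono order_trans)
  moreover have "norm (grad_x f x' y' - grad_x f x y) \<le> l * norm (x' - x) + l * norm (y' - y)"
    using gx_lip[OF x'X x y' y] by (simp add: distrib_left)
  moreover have "norm ((1 / c - rx) *\<^sub>R (x - x')) \<le> 1 / c * norm (x' - x)"
  proof -
    have "rx + l \<le> 1 / c" using c by (simp add: field_simps)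
    hence "\<bar>1 / c - rx\<bar> \<le> 1 / c" using rx l_pos by linarith
    from mult_right_mono[OF this norm_ge_zero[of "x' - x"]] show ?thesis
      by (simp add: norm_minus_commute[of x x'])
  qed
  moreover have "norm (rx *\<^sub>R (x' - z)) = rx * norm (x' - z)" using rx by simp
  moreover have "l * norm (x' - x) \<le> 1 / c * norm (x' - x)"
  proof (rule mult_right_mono)
    have "c * l \<le> c * (rx + l)" using c rx by (intro mult_left_mono) auto
    thus "l \<le> 1 / c" using c by (simp add: field_simps)
  qed simp
  ultimately show "norm (grad_x f x' y' + n)
      \<le> 2 * norm (x' - x) / c + l * norm (y' - y) + rx * norm (x' - z)" using rx by simp
qed

text \<open>As for \<open>x\<close>, but the gradient of the regularisation stays as a bias; since
  \<open>0\<close> lies in \<open>Y\<close> it is at most \<open>r * diameter Y\<close>.\<close>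

lemma y_residual:
  assumes x': "x' \<in> X" and y: "y \<in> Y" and r: "0 < r" and \<alpha>: "0 < \<alpha>" "11 * \<alpha> * (l + r) \<le> 1"
    and y': "y' = closest_point Y (y + \<alpha> *\<^sub>R gy r x' y)"
  obtains n where "\<And>w. w \<in> Y \<Longrightarrow> n \<bullet> (w - y') \<le> 0"
    and "norm (- grad_y f x' y' + n) \<le> 2 * norm (y' - y) / \<alpha> + r * diameter Y"
proof
  define n where "n = gy r x' y - (1 / \<alpha>) *\<^sub>R (y' - y)"
  have y'Y: "y' \<in> Y" using closest_point_in_set[OF Y_closed Y_ne] y' by simp
  show "n \<bullet> (w - y') \<le> 0" if "w \<in> Y" for w
  proof -
    have "(y + \<alpha> *\<^sub>R gy r x' y - y') \<bullet> (w - y') \<le> 0"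
      using closest_point_dot[OF Y_convex Y_closed that] by (simp add: y')
    moreover have "y + \<alpha> *\<^sub>R gy r x' y - y' = \<alpha> *\<^sub>R n" using \<alpha> by (simp add: n_def algebra_simps)
    ultimately show ?thesis using \<alpha> by (simp add: mult_le_0_iff)
  qed
  have "- grad_y f x' y' + n = (grad_y f x' y - grad_y f x' y') - (1 / \<alpha>) *\<^sub>R (y' - y) - r *\<^sub>R y"
    by (simp add: n_def gy_def algebra_simps)
  hence "norm (- grad_y f x' y' + n)
      \<le> norm (grad_y f x' y - grad_y f x' y') + norm ((1 / \<alpha>) *\<^sub>R (y' - y)) + norm (r *\<^sub>R y)"
    by (metis norm_triangle_ineq4 add_right_mono order_trans)
  moreover have "norm (grad_y f x' y - grad_y f x' y') \<le> l * norm (y' - y)"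
    using gy_lip[OF x' x' y y'Y] by (simp add: norm_minus_commute)
  moreover have "l * norm (y' - y) \<le> 1 / \<alpha> * norm (y' - y)"
  proof (rule mult_right_mono)
    have "0 \<le> \<alpha> * l" "0 \<le> \<alpha> * r" using \<alpha> r l_pos by auto
    hence "\<alpha> * l \<le> 1" using \<alpha> by (simp add: algebra_simps)
    thus "l \<le> 1 / \<alpha>" using \<alpha> by (simp add: field_simps)
  qed simp
  moreover have "norm ((1 / \<alpha>) *\<^sub>R (y' - y)) = 1 / \<alpha> * norm (y' - y)" using \<alpha> by simp
  moreover have "norm (r *\<^sub>R y) \<le> r * diameter Y" using r norm_Y_le[OF y] by simp
  moreover have "2 * norm (y' - y) / \<alpha> = 1 / \<alpha> * norm (y' - y) + 1 / \<alpha> * norm (y' - y)" by simp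
  ultimately show "norm (- grad_y f x' y' + n) \<le> 2 * norm (y' - y) / \<alpha> + r * diameter Y" by linarith
qed

lemma game_stationaryI:
  assumes x: "x \<in> X" and y: "y \<in> Y"
    and u: "\<And>w. w \<in> X \<Longrightarrow> u \<bullet> (w - x) \<le> 0" "norm (grad_x f x y + u) \<le> \<epsilon>"
    and v: "\<And>w. w \<in> Y \<Longrightarrow> v \<bullet> (w - y) \<le> 0" "norm (- grad_y f x y + v) \<le> \<epsilon>"
  shows "game_stationary f X Y \<epsilon> x y"
  unfolding game_stationary_def
  using x y u(2) v(2) subdifferential_convex_indicatorI[OF x u(1)] subdifferential_convex_indicatorI[OF y v(1)]
  by (auto intro!: infdist_le2)

text \<open>With \<open>rx = 2 * l\<close>, \<open>r = 0\<close> and centre \<open>x\<close>, the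
  function \<open>F\<close> is the objective of the proximal problem before maximising over
  \<open>y\<close>, so its saddle point yields the proximal point.\<close>

lemma prox_eq_saddle:
  assumes ys: "ys \<in> Y"
    and saddle: "\<forall>y'\<in>Y. F (2 * l) 0 x (xarg (2 * l) x ys, y') \<le> F (2 * l) 0 x (xarg (2 * l) x ys, ys)"
  shows "prox (1 / (2 * l)) (Phi f X Y) x = xarg (2 * l) x ys"
proof -
  have rx: "2 * l > l" using l_pos by simp
  define s where "s = xarg (2 * l) x ys"
  have s: "s \<in> X" unfolding s_def by (rule xarg_in[OF rx ys])
  define G where "G w = Phi f X Y w + ereal (1 / (2 * (1 / (2 * l))) * (norm (w - x))\<^sup>2)" for w
  define M where "M w = (SUP y\<in>Y. f (w, y))" for w
  have G: "G w = (if w \<in> X then ereal (M w + l * (norm (w - x))\<^sup>2) else \<infinity>)" for w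
    by (simp add: G_def Phi_def convex_indicator_def M_def)
  have bdd: "bdd_above ((\<lambda>y. f (w, y)) ` Y)" for w
    by (intro bounded_imp_bdd_above compact_imp_bounded compact_continuous_image Y_compact
        continuous_on_compose2[OF f_continuous[of UNIV]]) (auto intro!: continuous_intros)
  have "M s \<le> f (s, ys)" unfolding M_def
    by (rule cSUP_least[OF Y_ne]) (use saddle in \<open>auto simp: s_def F_eq\<close>)
  moreover have "f (w, ys) \<le> M w" for w unfolding M_def by (rule cSUP_upper[OF ys bdd])
  moreover have "f (s, ys) + l * (norm (s - x))\<^sup>2 + l / 2 * (norm (w - s))\<^sup>2 \<le> f (w, ys) + l * (norm (w - x))\<^sup>2"
    if "w \<in> X" for w
    using xarg_growth[OF rx ys that, of 0 x] by (simp add: s_def F_eq)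
  ultimately have *: "M s + l * (norm (s - x))\<^sup>2 + l / 2 * (norm (w - s))\<^sup>2 \<le> M w + l * (norm (w - x))\<^sup>2"
    if "w \<in> X" for w using that by (smt (verit))
  have s_min: "is_arg_min G (\<lambda>_. True) s"
    unfolding is_arg_min_linorder
  proof (intro conjI allI impI)
    fix w
    have "0 \<le> l / 2 * (norm (w - s))\<^sup>2" using l_pos by simp
    thus "G s \<le> G w" using *[of w] s by (auto simp: G)
  qed simp
  \<comment> \<open>\<open>arg_min\<close> is a choice, so \<open>s\<close> is identified only
    through uniqueness, which the quadratic growth provides.\<close>
  have uniq: "w = s" if w: "is_arg_min G (\<lambda>_. True) w" for w
  proof -
    have le: "G w \<le> G s" using w unfolding is_arg_min_linorder by blast
    hence wX: "w \<in> X" using s by (auto simp: G split: if_splits)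
    hence "M w + l * (norm (w - x))\<^sup>2 \<le> M s + l * (norm (s - x))\<^sup>2" using le s by (simp add: G)
    hence "l / 2 * (norm (w - s))\<^sup>2 \<le> 0" using *[OF wX] by linarith
    thus ?thesis using l_pos by (simp add: mult_le_0_iff)
  qed
  have "prox (1 / (2 * l)) (Phi f X Y) x = arg_min G (\<lambda>_. True)"
    unfolding prox_def G_def ..
  also have "\<dots> = s" unfolding arg_min_def using s_min uniq by (rule some_equality)
  finally show ?thesis by (simp add: s_def)
qed

text \<open>The pair \<open>(x, y)\<close> is compared with the saddle point of the proximal problem
  centred at \<open>x\<close>, where the proximal term has zero gradient. The distance
  \<open>N\<close> enters twice through strong convexity, while the \<open>y\<close>-residual enters
  only multiplied by the diameter.\<close>

lemma opt_stationaryI: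
  assumes x: "x \<in> X" and y: "y \<in> Y" and \<epsilon>: "0 < \<epsilon>"
    and u: "\<And>w. w \<in> X \<Longrightarrow> u \<bullet> (w - x) \<le> 0" "norm (grad_x f x y + u) \<le> \<epsilon> / 8"
    and v: "\<And>w. w \<in> Y \<Longrightarrow> v \<bullet> (w - y) \<le> 0"
      "norm (- grad_y f x y + v) * diameter Y \<le> \<epsilon>\<^sup>2 / (16 * l)"
  shows "opt_stationary f X Y l \<epsilon> x"
proof -
  have rx: "2 * l > l" using l_pos by simp
  obtain ys where ys: "ys \<in> Y"
    and sad: "\<forall>y'\<in>Y. F (2 * l) 0 x (xarg (2 * l) x ys, y') \<le> F (2 * l) 0 x (xarg (2 * l) x ys, ys)"
    using ex_saddle[OF rx, of 0 x] by auto
  define s where "s = xarg (2 * l) x ys"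
  have sX: "s \<in> X" unfolding s_def by (rule xarg_in[OF rx ys])
  define N where "N = norm (s - x)"
  have 1: "F (2 * l) 0 x (x, y) + grad_x f x y \<bullet> (s - x) + l / 2 * N\<^sup>2 \<le> F (2 * l) 0 x (s, y)"
    using F_x_lower[OF x sX y, of "2 * l" 0 x] by (simp add: gx_def N_def)
  have 2: "F (2 * l) 0 x (s, ys) + l / 2 * N\<^sup>2 \<le> F (2 * l) 0 x (x, ys)"
    using xarg_growth[OF rx ys x, of 0 x] by (simp add: s_def N_def norm_minus_commute)
  have 3: "F (2 * l) 0 x (s, y) \<le> F (2 * l) 0 x (s, ys)" using sad y by (simp add: s_def)
  have 4: "F (2 * l) 0 x (x, ys) \<le> F (2 * l) 0 x (x, y) + grad_y f x y \<bullet> (ys - y)"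
    using F_y_upper[OF x y ys, of "2 * l" 0 x] by (simp add: gy_def)
  have 5: "- (grad_x f x y \<bullet> (s - x)) \<le> \<epsilon> / 8 * N"
  proof -
    have "- (grad_x f x y \<bullet> (s - x)) \<le> - ((grad_x f x y + u) \<bullet> (s - x))"
      using u(1)[OF sX] by (simp add: inner_add_left)
    also have "\<dots> \<le> norm (grad_x f x y + u) * N"
      using norm_cauchy_schwarz[of "- (grad_x f x y + u)" "s - x"] unfolding N_def norm_minus_cancel inner_minus_left .
    also have "\<dots> \<le> \<epsilon> / 8 * N" using u(2) by (intro mult_right_mono) (auto simp: N_def)
    finally show ?thesis .
  qed
  have 6: "grad_y f x y \<bullet> (ys - y) \<le> \<epsilon>\<^sup>2 / (16 * l)"
  proof -
    have "grad_y f x y \<bullet> (ys - y) \<le> - ((- grad_y f x y + v) \<bullet> (ys - y))"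
      using v(1)[OF ys] by (simp add: inner_diff_left)
    also have "\<dots> \<le> norm (- grad_y f x y + v) * norm (ys - y)"
      using norm_cauchy_schwarz[of "- (- grad_y f x y + v)" "ys - y"] unfolding norm_minus_cancel inner_minus_left .
    also have "\<dots> \<le> norm (- grad_y f x y + v) * diameter Y"
      using diameter_bounded_bound[OF compact_imp_bounded[OF Y_compact] ys y]
      by (intro mult_left_mono) (auto simp: dist_norm)
    finally show ?thesis using v(2) by linarith
  qed
  have 7: "l * N\<^sup>2 - \<epsilon> / 8 * N \<le> \<epsilon>\<^sup>2 / (16 * l)" using 1 2 3 4 5 6 by linarith
  have "N \<le> \<epsilon> / (2 * l)"
  proof (rule ccontr)
    assume "\<not> N \<le> \<epsilon> / (2 * l)"
    hence N: "\<epsilon> / (2 * l) < N" by simp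
    hence "\<epsilon> / 2 < l * N" using l_pos by (simp add: field_simps)
    moreover have "0 \<le> N" by (simp add: N_def)
    \<comment> \<open>With \<open>N\<close> beyond the threshold the product is at least
      \<open>3 * \<epsilon>\<^sup>2 / (16 * l)\<close>, three times what inequality 7
      permits.\<close>
    ultimately have "(\<epsilon> / (2 * l)) * (3 / 8 * \<epsilon>) \<le> N * (l * N - \<epsilon> / 8)"
      using N \<epsilon> l_pos by (intro mult_mono) (auto simp: mult_ac)
    also have "\<dots> \<le> \<epsilon>\<^sup>2 / (16 * l)" using 7 by (simp add: power2_eq_square algebra_simps)
    finally have "\<epsilon> * \<epsilon> * (3 / (16 * l)) \<le> \<epsilon> * \<epsilon> * (1 / (16 * l))"
      by (simp add: power2_eq_square)
    hence "3 / (16 * l) \<le> 1 / (16 * l)" using \<epsilon> by (simp only: mult_le_cancel_left_pos mult_pos_pos)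
    thus False using l_pos by (simp add: field_simps)
  qed
  thus ?thesis unfolding opt_stationary_def prox_eq_saddle[OF ys sad] using x by (simp add: N_def s_def)
qed

end

section \<open>Complexity of a run with constant regularisation\<close>

locale gda_run = smooth_minimax f X Y l
  for f :: "'a::euclidean_space \<times> 'b::euclidean_space \<Rightarrow> real" and X Y l +
  fixes k K rx r :: real and ry c \<alpha> \<beta> and x :: "nat \<Rightarrow> 'a" and y :: "nat \<Rightarrow> 'b" and z \<Delta>
  assumes run: "perturbed_smoothed_gda f X Y rx ry c \<alpha> \<beta> x y z"
    and steps: "step_size_conditions k K l rx ry c \<alpha> \<beta>"
    and bounded: "gap_finite f X Y (ry 0)"
    and gap: "\<Delta> = initial_gap f X Y rx (ry 0) (x 0) (y 0) (z 0)"
    and ry: "\<forall>t. ry t = r" and r_small: "r < 2 * l" and k_pos: "0 < k"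
begin

lemmas consequences = step_size_consequences[OF steps l_pos ry[rule_format] r_small]

lemma x_Suc: "x (Suc t) = closest_point X (x t - c t *\<^sub>R gx rx (z t) (x t) (y t))"
  and y_Suc: "y (Suc t) = closest_point Y (y t + \<alpha> t *\<^sub>R gy r (x (Suc t)) (y t))"
  and z_Suc: "z (Suc t) = z t + \<beta> t *\<^sub>R (x (Suc t) - z t)"
  using run unfolding perturbed_smoothed_gda_def grad_x_F grad_y_F ry[rule_format] by blast+

lemma x_in: "x t \<in> X"
  using run closest_point_in_set[OF X_closed X_ne]
  by (cases t) (auto simp: perturbed_smoothed_gda_def)

lemma y_in: "y t \<in> Y"
  using run closest_point_in_set[OF Y_closed Y_ne]
  by (cases t) (auto simp: perturbed_smoothed_gda_def)

text \<open>The guaranteed decrease of the Lyapunov function in iteration \<open>t\<close>, as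
  supplied by \<open>descent_step\<close>.\<close>

definition progress where
  "progress t = (norm (x (Suc t) - x t))\<^sup>2 / (4 * c t) + (norm (y (Suc t) - y t))\<^sup>2 / (8 * \<alpha> t)
     + rx * \<beta> t / 3 * (norm (x (Suc t) - z t))\<^sup>2"

lemma descent:
  "Psi2 f X Y rx r (x (Suc t)) (y (Suc t)) (z (Suc t)) + progress t \<le> Psi2 f X Y rx r (x t) (y t) (z t)"
  using descent_step[OF consequences(1-10) x_in y_in x_Suc y_Suc z_Suc]
  unfolding progress_def by (simp add: add.assoc)

lemma sum_progress: "(\<Sum>t<T. progress t) \<le> \<Delta>"
proof -
  have rxl: "rx > l" using consequences(2) l_pos by simp
  have "Psi2 f X Y rx r (x T) (y T) (z T) + (\<Sum>t<T. progress t) \<le> Psi2 f X Y rx r (x 0) (y 0) (z 0)"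
  proof (induction T)
    case (Suc T)
    thus ?case using descent[of T] by simp
  qed simp
  moreover have "(INF x\<in>X. primal_reg f Y r x) \<le> Psi2 f X Y rx r (x T) (y T) (z T)"
    using consequences(1) bounded unfolding ry[rule_format]
    by (intro Psi2_lower_bound[OF rxl] x_in y_in) auto
  ultimately show ?thesis unfolding gap initial_gap_def ry[rule_format] by linarith
qed

lemma progress_nonneg:
  "0 \<le> (norm (x (Suc t) - x t))\<^sup>2 / (4 * c t)" "0 \<le> (norm (y (Suc t) - y t))\<^sup>2 / (8 * \<alpha> t)"
  "0 \<le> rx * \<beta> t / 3 * (norm (x (Suc t) - z t))\<^sup>2"
  using consequences(2) consequences(3,5,8)[of t] l_pos by auto

text \<open>If the gap vanishes then the very first step makes no progress, so the initial pair is
  its own successor.\<close>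

lemma ex_small_progress:
  assumes \<delta>: "0 < \<delta>" and \<Delta>: "\<Delta> = 0 \<or> \<delta> \<le> \<Delta>"
  obtains s t where "real s \<le> 2 * (\<Delta> / \<delta>)" "progress t \<le> \<delta>" "x s = x (Suc t)" "y s = y (Suc t)"
proof (cases "\<Delta> = 0")
  case True
  have "progress 0 \<le> 0" using sum_progress[of 1] True by simp
  hence "(norm (x (Suc 0) - x 0))\<^sup>2 / (4 * c 0) = 0" "(norm (y (Suc 0) - y 0))\<^sup>2 / (8 * \<alpha> 0) = 0"
    using progress_nonneg[of 0] unfolding progress_def by linarith+
  hence "x 0 = x (Suc 0)" "y 0 = y (Suc 0)" using consequences(3,5)[of 0] by auto
  thus thesis using that[of 0 0] True \<open>progress 0 \<le> 0\<close> \<delta> by simp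
next
  case False
  hence Q: "1 \<le> \<Delta> / \<delta>" using \<Delta> \<delta> by simp
  \<comment> \<open>Since the quotient is at least 1, rounding up at most doubles it; the index
    \<open>Suc t\<close> with \<open>t < T\<close> still obeys this bound.\<close>
  define T where "T = nat \<lceil>\<Delta> / \<delta>\<rceil>"
  have T1: "\<Delta> / \<delta> \<le> real T" unfolding T_def by linarith
  have T2: "real T \<le> 2 * (\<Delta> / \<delta>)" unfolding T_def using Q by linarith
  have "\<exists>t<T. progress t \<le> \<delta>"
  proof (rule ccontr)
    assume "\<not> (\<exists>t<T. progress t \<le> \<delta>)"
    hence less: "\<delta> < progress t" if "t < T" for t using that by force
    have "T > 0" using Q T1 by (cases T) auto
    hence "(\<Sum>t<T. \<delta>) < (\<Sum>t<T. progress t)" using less by (intro sum_strict_mono) auto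
    hence "real T * \<delta> < \<Delta>" using sum_progress[of T] by simp
    thus False using T1 \<delta> by (simp add: field_simps)
  qed
  then obtain t where "t < T" "progress t \<le> \<delta>" by blast
  thus thesis using that[of "Suc t" t] T2 by simp
qed

text \<open>Common core of both rates: \<open>\<delta>\<close> fixes the number of iterations, and
  the conditions on \<open>\<eta>\<close> and \<open>\<zeta>\<close> say which residuals a decrease
  of at most \<open>\<delta>\<close> certifies.\<close>

lemma ex_small_residuals:
  assumes \<delta>: "0 < \<delta>" and \<Delta>: "\<Delta> = 0 \<or> \<delta> \<le> \<Delta>" and \<eta>: "0 \<le> \<eta>" "\<delta> * l / k \<le> \<eta>\<^sup>2"
    and \<zeta>: "0 \<le> \<zeta>" "3 * K * l\<^sup>2 * \<delta> / (k * r) \<le> \<zeta>\<^sup>2"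
  obtains s u v where "real s \<le> 2 * (\<Delta> / \<delta>)"
    "\<And>w. w \<in> X \<Longrightarrow> u \<bullet> (w - x s) \<le> 0" "norm (grad_x f (x s) (y s) + u) \<le> 5 * \<eta> + \<zeta>"
    "\<And>w. w \<in> Y \<Longrightarrow> v \<bullet> (w - y s) \<le> 0" "norm (- grad_y f (x s) (y s) + v) \<le> 6 * \<eta> + r * diameter Y"
proof -
  obtain s t where s: "real s \<le> 2 * (\<Delta> / \<delta>)" "x s = x (Suc t)" "y s = y (Suc t)" and t: "progress t \<le> \<delta>"
    by (rule ex_small_progress[OF \<delta> \<Delta>]) (rule that)
  note C = consequences
  have rx: "0 < rx" using C(2) l_pos by simp
  have "0 \<le> \<alpha> t * r" using C(1) C(5)[of t] by simp
  hence l\<alpha>: "l * \<alpha> t \<le> 1 / 11" using C(6)[of t] by (simp add: algebra_simps)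
  have res: "2 * norm (x (Suc t) - x t) / c t + l * norm (y (Suc t) - y t) + rx * norm (x (Suc t) - z t) \<le> 5 * \<eta> + \<zeta>"
    "2 * norm (y (Suc t) - y t) / \<alpha> t \<le> 6 * \<eta>"
    using residual_arithmetic[OF l_pos k_pos C(1) rx C(14,12,11) l\<alpha> C(13) _ _ _ _ \<eta>(1) \<zeta>(1)
        t[unfolded progress_def] \<eta>(2) \<zeta>(2)] \<delta> by simp_all
  obtain u where u: "\<And>w. w \<in> X \<Longrightarrow> u \<bullet> (w - x (Suc t)) \<le> 0"
    "norm (grad_x f (x (Suc t)) (y (Suc t)) + u)
      \<le> 2 * norm (x (Suc t) - x t) / c t + l * norm (y (Suc t) - y t) + rx * norm (x (Suc t) - z t)"
    by (rule x_residual[OF x_in y_in y_in[of "Suc t"] rx C(3,4) x_Suc[of t]], rule that) blast+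
  obtain v where v: "\<And>w. w \<in> Y \<Longrightarrow> v \<bullet> (w - y (Suc t)) \<le> 0"
    "norm (- grad_y f (x (Suc t)) (y (Suc t)) + v) \<le> 2 * norm (y (Suc t) - y t) / \<alpha> t + r * diameter Y"
    by (rule y_residual[OF x_in y_in C(1,5,6) y_Suc[of t]], rule that) blast+
  show thesis
  proof (rule that[of s u v])
    show "norm (grad_x f (x s) (y s) + u) \<le> 5 * \<eta> + \<zeta>"
      unfolding s(2,3) using u(2) res(1) by linarith
    show "norm (- grad_y f (x s) (y s) + v) \<le> 6 * \<eta> + r * diameter Y"
      unfolding s(2,3) using v(2) res(2) by linarith
  qed (use s(1) u(1) v(1) in \<open>simp_all add: s(2,3)\<close>)
qed

end

section \<open>The two iteration bounds\<close>

lemma game_stationarity: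
  assumes k: "0 < k" "k \<le> K" and a: "0 < a" "a \<le> b" "b \<le> 1 / 4"
    and l: "0 < l" and D: "0 < D" and \<Delta>0: "0 < \<Delta>0"
    and \<epsilon>: "0 < \<epsilon>" "\<epsilon> < Min {1, l * D, K * l * D / (12 * a), l\<^sup>2 * D * \<Delta>0 / (k * a / (12 * K))}"
    and prob: "minimax_problem f X Y l" "diameter Y = D"
    and iter: "perturbed_smoothed_gda f X Y rx ry c \<alpha> \<beta> x y z" "step_size_conditions k K l rx ry c \<alpha> \<beta>"
    and init: "gap_finite f X Y (ry 0)" "\<Delta> = initial_gap f X Y rx (ry 0) (x 0) (y 0) (z 0)"
      "\<Delta> = 0 \<or> \<Delta>0 \<le> \<Delta>"
    and r: "\<forall>t. ry t = r" "theta_with a b r (\<epsilon> / D)"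
  shows "\<exists>t. real t \<le> 2 / (k * a / (12 * K)) * (l\<^sup>2 * D * \<Delta> / \<epsilon> ^ 3) \<and> game_stationary f X Y \<epsilon> (x t) (y t)"
proof -
  have K: "0 < K" using k by simp
  define c' where "c' = k * a / (12 * K)"
  have c': "0 < c'" using k a K by (simp add: c'_def)
  have \<epsilon>1: "\<epsilon> < 1" "\<epsilon> < l * D" "\<epsilon> < K * l * D / (12 * a)" "\<epsilon> < l\<^sup>2 * D * \<Delta>0 / c'"
    using \<epsilon>(2) by (simp_all add: c'_def)
  \<comment> \<open>The constant in \<open>c'\<close> makes the requirement for
    \<open>\<zeta> = \<epsilon> / 2\<close> an equality at the smallest admissible \<open>r\<close>,
    namely \<open>a * \<epsilon> / D\<close>.\<close>
  define \<delta> where "\<delta> = c' * \<epsilon> ^ 3 / (l\<^sup>2 * D)"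
  have \<delta>: "0 < \<delta>" using c' \<epsilon> l D by (simp add: \<delta>_def)
  have rl: "a * \<epsilon> / D \<le> r" and ru: "r \<le> b * \<epsilon> / D" using r(2) by (auto simp: theta_with_def)
  have rD: "r * D \<le> \<epsilon> / 4"
  proof -
    have "r * D \<le> b * \<epsilon>" using ru D by (simp add: field_simps)
    also have "\<dots> \<le> 1 / 4 * \<epsilon>" using a \<epsilon> by (intro mult_right_mono) auto
    finally show ?thesis by simp
  qed
  have r2: "r < 2 * l"
  proof -
    have "r * D < (2 * l) * D" using rD \<epsilon>1(2) mult_pos_pos[OF l D] by linarith
    thus ?thesis using D by simp
  qed
  interpret gda_run f X Y l k K rx r ry c \<alpha> \<beta> x y z \<Delta>
    by unfold_locales (use prob iter init r r2 k in auto)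
  have \<delta>\<Delta>: "\<Delta> = 0 \<or> \<delta> \<le> \<Delta>"
  proof -
    have "\<epsilon> ^ 3 \<le> \<epsilon>" using \<epsilon> \<epsilon>1 by (simp add: power_le_one_iff power3_eq_cube mult_le_cancel_left1 mult_le_one)
    hence "\<epsilon> ^ 3 \<le> l\<^sup>2 * D * \<Delta>0 / c'" using \<epsilon>1(4) by linarith
    hence "\<delta> \<le> \<Delta>0" using c' l D by (simp add: \<delta>_def field_simps)
    thus ?thesis using init(3) by linarith
  qed
  have \<eta>: "\<delta> * l / k \<le> (\<epsilon> / 12)\<^sup>2"
  proof -
    have "\<delta> * l / k = (a * \<epsilon> / (12 * K * l * D)) * \<epsilon>\<^sup>2"
      using k K l D by (simp add: \<delta>_def c'_def field_simps power2_eq_square power3_eq_cube)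
    also have "\<dots> \<le> 1 / 144 * \<epsilon>\<^sup>2"
    proof (rule mult_right_mono)
      show "a * \<epsilon> / (12 * K * l * D) \<le> 1 / 144" using \<epsilon>1(3) a K l D by (simp add: field_simps)
    qed simp
    finally show ?thesis by (simp add: power_divide)
  qed
  have \<zeta>: "3 * K * l\<^sup>2 * \<delta> / (k * r) \<le> (\<epsilon> / 2)\<^sup>2"
  proof -
    have "0 < a * \<epsilon> / D" using a \<epsilon> D by simp
    hence "3 * K * l\<^sup>2 * \<delta> / (k * r) \<le> 3 * K * l\<^sup>2 * \<delta> / (k * (a * \<epsilon> / D))"
      using rl k K \<delta> by (intro divide_left_mono mult_left_mono mult_pos_pos) auto
    also have "\<dots> = (\<epsilon> / 2)\<^sup>2"
      using a k K l D \<epsilon> by (simp add: \<delta>_def c'_def field_simps power2_eq_square power3_eq_cube)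
    finally show ?thesis .
  qed
  \<comment> \<open>The \<open>x\<close>-residual becomes \<open>5/12 + 1/2\<close> of
    \<open>\<epsilon>\<close>; the \<open>y\<close>-residual is \<open>1/2\<close> of it plus the
    bias \<open>r * D\<close>, at most a quarter.\<close>
  have \<epsilon>0: "0 \<le> \<epsilon> / 12" "0 \<le> \<epsilon> / 2" using \<epsilon> by simp_all
  obtain s u v where s: "real s \<le> 2 * (\<Delta> / \<delta>)"
    "\<And>w. w \<in> X \<Longrightarrow> u \<bullet> (w - x s) \<le> 0" "norm (grad_x f (x s) (y s) + u) \<le> 5 * (\<epsilon> / 12) + \<epsilon> / 2"
    "\<And>w. w \<in> Y \<Longrightarrow> v \<bullet> (w - y s) \<le> 0" "norm (- grad_y f (x s) (y s) + v) \<le> 6 * (\<epsilon> / 12) + r * diameter Y"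
    by (rule ex_small_residuals[OF \<delta> \<delta>\<Delta> \<epsilon>0(1) \<eta> \<epsilon>0(2) \<zeta>], rule that) blast+
  have "game_stationary f X Y \<epsilon> (x s) (y s)"
    by (rule game_stationaryI[where u = u and v = v, OF x_in y_in]) (use s \<epsilon> rD prob in auto)
  moreover have "2 * (\<Delta> / \<delta>) = 2 / c' * (l\<^sup>2 * D * \<Delta> / \<epsilon> ^ 3)"
    using c' \<epsilon> l D by (simp add: \<delta>_def field_simps)
  ultimately show ?thesis using s(1) unfolding c'_def by (intro exI[of _ s] conjI) (simp_all only:)
qed

lemma optimization_stationarity:
  assumes k: "0 < k" "k \<le> K" and a: "0 < a" "a \<le> b" "b \<le> 1 / 32"
    and l: "0 < l" and D: "0 < D" and \<Delta>0: "0 < \<Delta>0" and c'_def: "c' = min (k / 36864) (k * a / (768 * K))"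
    and \<epsilon>: "0 < \<epsilon>" "\<epsilon> < Min {1, l * D, l ^ 3 * D\<^sup>2 * \<Delta>0 / c'}"
    and prob: "minimax_problem f X Y l" "diameter Y = D"
    and iter: "perturbed_smoothed_gda f X Y rx ry c \<alpha> \<beta> x y z" "step_size_conditions k K l rx ry c \<alpha> \<beta>"
    and init: "gap_finite f X Y (ry 0)" "\<Delta> = initial_gap f X Y rx (ry 0) (x 0) (y 0) (z 0)"
      "\<Delta> = 0 \<or> \<Delta>0 \<le> \<Delta>"
    and r: "\<forall>t. ry t = r" "theta_with a b r (\<epsilon>\<^sup>2 / (l * D\<^sup>2))"
  shows "\<exists>t. real t \<le> 2 / c' * (l ^ 3 * D\<^sup>2 * \<Delta> / \<epsilon> ^ 4) \<and> opt_stationary f X Y l \<epsilon> (x t)"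
proof -
  have K: "0 < K" using k by simp
  have c': "0 < c'" "c' \<le> k / 36864" "c' \<le> k * a / (768 * K)" using k a K by (auto simp: c'_def)
  have \<epsilon>1: "\<epsilon> < 1" "\<epsilon> < l * D" "\<epsilon> < l ^ 3 * D\<^sup>2 * \<Delta>0 / c'" using \<epsilon>(2) by simp_all
  \<comment> \<open>Of the two bounds on \<open>c'\<close>, the one with
    \<open>36864 = 192\<^sup>2\<close> serves
    \<open>\<eta> = \<epsilon>\<^sup>2 / (192 * l * D)\<close>, the one with
    \<open>768 = 3 * 16\<^sup>2\<close> serves \<open>\<zeta> = \<epsilon> / 16\<close>.\<close>
  define \<delta> where "\<delta> = c' * \<epsilon> ^ 4 / (l ^ 3 * D\<^sup>2)"
  have \<delta>: "0 < \<delta>" using c' \<epsilon> l D by (simp add: \<delta>_def)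
  have rl: "a * \<epsilon>\<^sup>2 / (l * D\<^sup>2) \<le> r" and ru: "r \<le> b * \<epsilon>\<^sup>2 / (l * D\<^sup>2)"
    using r(2) by (auto simp: theta_with_def)
  define W where "W = \<epsilon>\<^sup>2 / (16 * l)"
  have rD: "r * D\<^sup>2 \<le> W / 2"
  proof -
    have "r * D\<^sup>2 \<le> b * (\<epsilon>\<^sup>2 / l)" using ru D l by (simp add: field_simps)
    also have "\<dots> \<le> 1 / 32 * (\<epsilon>\<^sup>2 / l)" using a l by (intro mult_right_mono) auto
    finally show ?thesis by (simp add: W_def)
  qed
  have r2: "r < 2 * l"
  proof -
    have "\<epsilon>\<^sup>2 < (l * D)\<^sup>2" using \<epsilon> \<epsilon>1(2) by (intro power_strict_mono) auto
    hence "W / 2 < (l * D)\<^sup>2 / (32 * l)" using l by (simp add: W_def divide_strict_right_mono)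
    also have "\<dots> = l / 32 * D\<^sup>2" using l by (simp add: power_mult_distrib power2_eq_square)
    also have "\<dots> \<le> (2 * l) * D\<^sup>2" using l by (intro mult_right_mono) auto
    finally have "r * D\<^sup>2 < (2 * l) * D\<^sup>2" using rD by linarith
    thus ?thesis using D by simp
  qed
  interpret gda_run f X Y l k K rx r ry c \<alpha> \<beta> x y z \<Delta>
    by unfold_locales (use prob iter init r r2 k in auto)
  have \<delta>\<Delta>: "\<Delta> = 0 \<or> \<delta> \<le> \<Delta>"
  proof -
    have "\<epsilon> ^ 4 \<le> \<epsilon> ^ 1" using \<epsilon> \<epsilon>1 by (intro power_decreasing) auto
    hence "\<epsilon> ^ 4 \<le> l ^ 3 * D\<^sup>2 * \<Delta>0 / c'" using \<epsilon>1(3) by simp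
    hence "\<delta> \<le> \<Delta>0" using c' l D by (simp add: \<delta>_def field_simps)
    thus ?thesis using init(3) by linarith
  qed
  \<comment> \<open>Chosen so that \<open>6 * \<eta> * D\<close> is half of \<open>W\<close>, the
    tolerance for the \<open>y\<close>-residual times the diameter; the bias
    \<open>r * D\<^sup>2\<close> takes the other half.\<close>
  define \<eta> where "\<eta> = W / (12 * D)"
  have \<eta>0: "0 \<le> \<eta>" using l D by (simp add: \<eta>_def W_def)
  have \<eta>: "\<delta> * l / k \<le> \<eta>\<^sup>2"
  proof -
    have "\<delta> * l / k = c' / k * (\<epsilon> ^ 4 / (l\<^sup>2 * D\<^sup>2))"
      using k l D by (simp add: \<delta>_def field_simps power2_eq_square power3_eq_cube)
    also have "\<dots> \<le> 1 / 36864 * (\<epsilon> ^ 4 / (l\<^sup>2 * D\<^sup>2))"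
      using c' k by (intro mult_right_mono) (auto simp: field_simps)
    also have "\<dots> = \<eta>\<^sup>2" using l D by (simp add: \<eta>_def W_def field_simps power2_eq_square power4_eq_xxxx)
    finally show ?thesis .
  qed
  have \<zeta>: "3 * K * l\<^sup>2 * \<delta> / (k * r) \<le> (\<epsilon> / 16)\<^sup>2"
  proof -
    have "0 < a * \<epsilon>\<^sup>2 / (l * D\<^sup>2)" using a \<epsilon> D l by simp
    hence "3 * K * l\<^sup>2 * \<delta> / (k * r) \<le> 3 * K * l\<^sup>2 * \<delta> / (k * (a * \<epsilon>\<^sup>2 / (l * D\<^sup>2)))"
      using rl k K \<delta> by (intro divide_left_mono mult_left_mono mult_pos_pos) auto
    also have "\<dots> = c' * (3 * K / (k * a) * \<epsilon>\<^sup>2)"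
      using a k K l D \<epsilon> by (simp add: \<delta>_def field_simps power2_eq_square power3_eq_cube power4_eq_xxxx)
    also have "\<dots> \<le> k * a / (768 * K) * (3 * K / (k * a) * \<epsilon>\<^sup>2)"
      using c' a k K by (intro mult_right_mono) auto
    also have "\<dots> = (\<epsilon> / 16)\<^sup>2" using a k K by (simp add: power_divide)
    finally show ?thesis .
  qed
  have \<epsilon>0: "0 \<le> \<epsilon> / 16" using \<epsilon> by simp
  obtain s u v where s: "real s \<le> 2 * (\<Delta> / \<delta>)"
    "\<And>w. w \<in> X \<Longrightarrow> u \<bullet> (w - x s) \<le> 0" "norm (grad_x f (x s) (y s) + u) \<le> 5 * \<eta> + \<epsilon> / 16"
    "\<And>w. w \<in> Y \<Longrightarrow> v \<bullet> (w - y s) \<le> 0" "norm (- grad_y f (x s) (y s) + v) \<le> 6 * \<eta> + r * diameter Y"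
    by (rule ex_small_residuals[OF \<delta> \<delta>\<Delta> \<eta>0 \<eta> \<epsilon>0 \<zeta>], rule that) blast+
  have "opt_stationary f X Y l \<epsilon> (x s)"
  proof (rule opt_stationaryI[where u = u and v = v, OF x_in y_in \<epsilon>(1)])
    have "\<epsilon> * \<epsilon> \<le> l * D * \<epsilon>" using \<epsilon>1(2) \<epsilon>(1) by (intro mult_right_mono) auto
    hence "\<eta> \<le> \<epsilon> / 192" using l D by (simp add: \<eta>_def W_def field_simps power2_eq_square)
    thus "norm (grad_x f (x s) (y s) + u) \<le> \<epsilon> / 8" using s(3) \<epsilon> by linarith
    have "norm (- grad_y f (x s) (y s) + v) * diameter Y \<le> (6 * \<eta> + r * diameter Y) * diameter Y"
      using s(5) D prob by (intro mult_right_mono) auto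
    also have "\<dots> = 6 * \<eta> * D + r * D\<^sup>2" using prob by (simp add: power2_eq_square algebra_simps)
    also have "\<dots> \<le> W" using rD D by (simp add: \<eta>_def)
    finally show "norm (- grad_y f (x s) (y s) + v) * diameter Y \<le> \<epsilon>\<^sup>2 / (16 * l)" by (simp add: W_def)
  qed (use s in auto)
  moreover have "2 * (\<Delta> / \<delta>) = 2 / c' * (l ^ 3 * D\<^sup>2 * \<Delta> / \<epsilon> ^ 4)"
    using c' \<epsilon> l D by (simp add: \<delta>_def field_simps)
  ultimately show ?thesis using s(1) by (intro exI[of _ s] conjI) (simp_all only:)
qed

text \<open>The order of quantifiers expresses the \<open>O\<close>: \<open>C\<close> depends on the
  hidden constants \<open>k\<close>, \<open>K\<close>, \<open>a\<close>, \<open>b\<close> alone,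
  while the threshold for \<open>\<epsilon>\<close> may also depend on \<open>l\<close>,
  \<open>D\<close> and a lower bound for a nonzero gap. The cap \<open>\<kappa>\<close>, here
  \<open>1 / 4\<close> and \<open>1 / 32\<close>, keeps the bias of the regularisation below the
  tolerance.\<close>

theorem theorem3p3:
  shows
    "(\<exists>\<kappa>>0. \<forall>k K a b. 0 < k \<and> k \<le> K \<and> 0 < a \<and> a \<le> b \<and> b \<le> \<kappa> \<longrightarrow>
       (\<exists>C>0. \<forall>l>0. \<forall>D>0. \<forall>\<Delta>\<^sub>0>0. \<exists>\<epsilon>\<^sub>0>0. \<forall>\<epsilon>. 0 < \<epsilon> \<and> \<epsilon> < \<epsilon>\<^sub>0 \<longrightarrow>
         (\<forall>(f :: 'a::euclidean_space \<times> 'b::euclidean_space \<Rightarrow> real) X Y x y z rx ry c \<alpha> \<beta> r \<Delta>.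
            minimax_problem f X Y l \<and> diameter Y = D \<and>
            perturbed_smoothed_gda f X Y rx ry c \<alpha> \<beta> x y z \<and>
            step_size_conditions k K l rx ry c \<alpha> \<beta> \<and>
            gap_finite f X Y (ry 0) \<and>
            \<Delta> = initial_gap f X Y rx (ry 0) (x 0) (y 0) (z 0) \<and> (\<Delta> = 0 \<or> \<Delta>\<^sub>0 \<le> \<Delta>) \<and>
            (\<forall>t. ry t = r) \<and> theta_with a b r (\<epsilon> / D)
            \<longrightarrow> (\<exists>t. real t \<le> C * (l\<^sup>2 * D * \<Delta> / \<epsilon> ^ 3) \<and> game_stationary f X Y \<epsilon> (x t) (y t)))))
     \<and>
     (\<exists>\<kappa>>0. \<forall>k K a b. 0 < k \<and> k \<le> K \<and> 0 < a \<and> a \<le> b \<and> b \<le> \<kappa> \<longrightarrow>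
       (\<exists>C>0. \<forall>l>0. \<forall>D>0. \<forall>\<Delta>\<^sub>0>0. \<exists>\<epsilon>\<^sub>0>0. \<forall>\<epsilon>. 0 < \<epsilon> \<and> \<epsilon> < \<epsilon>\<^sub>0 \<longrightarrow>
         (\<forall>(f :: 'a \<times> 'b \<Rightarrow> real) X Y x y z rx ry c \<alpha> \<beta> r \<Delta>.
            minimax_problem f X Y l \<and> diameter Y = D \<and>
            perturbed_smoothed_gda f X Y rx ry c \<alpha> \<beta> x y z \<and>
            step_size_conditions k K l rx ry c \<alpha> \<beta> \<and>
            gap_finite f X Y (ry 0) \<and>
            \<Delta> = initial_gap f X Y rx (ry 0) (x 0) (y 0) (z 0) \<and> (\<Delta> = 0 \<or> \<Delta>\<^sub>0 \<le> \<Delta>) \<and>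
            (\<forall>t. ry t = r) \<and> theta_with a b r (\<epsilon>\<^sup>2 / (l * D\<^sup>2))
            \<longrightarrow> (\<exists>t. real t \<le> C * (l ^ 3 * D\<^sup>2 * \<Delta> / \<epsilon> ^ 4) \<and> opt_stationary f X Y l \<epsilon> (x t)))))"
proof (rule conjI, goal_cases)
  case 1
  show ?case
  proof (rule exI[of _ "1 / 4"], intro conjI allI impI, goal_cases)
    case (2 k K a b)
    note H = 2
    show ?case
    proof (rule exI[of _ "2 / (k * a / (12 * K))"], intro conjI allI impI, goal_cases)
      case 1
      show ?case using H by simp
    next
      case (2 l D \<Delta>0)
      note pos = 2
      show ?case
      proof (rule exI[of _ "Min {1, l * D, K * l * D / (12 * a), l\<^sup>2 * D * \<Delta>0 / (k * a / (12 * K))}"],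
          intro conjI allI impI, goal_cases)
        case 1
        show ?case using H pos by simp
      next
        case (2 \<epsilon> f X Y x y z rx ry c \<alpha> \<beta> r \<Delta>)
        show ?case
          by (rule game_stationarity[of k K a b l D \<Delta>0 \<epsilon> f X Y rx ry c \<alpha> \<beta> x y z \<Delta> r])
            (use H pos 2 in blast)+
      qed
    qed
  qed simp
next
  case 2
  show ?case
  proof (rule exI[of _ "1 / 32"], intro conjI allI impI, goal_cases)
    case (2 k K a b)
    note H = 2
    define c' where "c' = min (k / 36864) (k * a / (768 * K))"
    have c': "0 < c'" using H by (auto simp: c'_def)
    show ?case
    proof (rule exI[of _ "2 / c'"], intro conjI allI impI, goal_cases)
      case 1
      show ?case using c' by simp
    next
      case (2 l D \<Delta>0)
      note pos = 2
      show ?case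
      proof (rule exI[of _ "Min {1, l * D, l ^ 3 * D\<^sup>2 * \<Delta>0 / c'}"], intro conjI allI impI, goal_cases)
        case 1
        show ?case using c' pos by simp
      next
        case (2 \<epsilon> f X Y x y z rx ry c \<alpha> \<beta> r \<Delta>)
        show ?case
          by (rule optimization_stationarity[of k K a b l D \<Delta>0 c' \<epsilon> f X Y rx ry c \<alpha> \<beta> x y z \<Delta> r])
            (use H pos 2 c'_def in blast)+
      qed
    qed
  qed simp
qed

end
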